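(* Let $X$, $Y$ be real normed spaces, $G\subset X$ open, $f,g_1,\dots,g_k,h_1,\dots,h_\ell : G\times Y\to\mathbb{R}$ functions, and for $\pi\in Y$ let $V(\pi)$ be the value of the problem $$(\mathcal M,\pi):\quad \text{maximize } f(x,\pi)\ \text{ subject to } x\in G,\ g_i(x,\pi)\ge 0\ (1\le i\le k),\ h_j(x,\pi)=0\ (1\le j\le \ell).$$ Let $\pi_0\in Y$. Assume: (Dua) there is an inner product on the dual $X^*$ which is continuous as a function $X^*\times X^*\to\mathbb{R}$ for the usual dual norm topology; (Sol1) there is an open neighborhood $P$ of $\pi_0$ in $Y$ such that for every $\pi\in P$ there is a solution $\underline{x}(\pi)$ of $(\mathcal M,\pi)$ (this fixes a map $\pi\mapsto\underline{x}(\pi)$ on $P$); (Sol2) there is $\varpi\in Y$ such that $D^+_G\underline{x}(\pi_0;\varpi)$ exists; (Fon1) for every $\psi\in\{f,g_1,\dots,g_k,h_1,\dots,h_\ell\}$, $D_H\psi(\underline{x}(\pi_0),\pi_0)$ exists, and for all $\pi\in P$, $D_{H,1}\psi(\underline{x}(\pi),\pi)$ exists and $\pi\mapsto D_{H,1}\psi(\underline{x}(\pi),\pi)$ is continuous on $P$; (Con1) for all $\pi\in P$ and all $j$, $x\mapsto h_j(x,\pi)$ is continuous on a neighborhood of $\underline{x}(\pi)$; (Con2) $D_{H,1}g_1(\underline{x}(\pi_0),\pi_0),\dots,D_{H,1}g_k(\underline{x}(\pi_0),\pi_0),D_{H,1}h_1(\underline{x}(\pi_0),\pi_0),\dots,D_{H,1}h_\ell(\underline{x}(\pi_0),\pi_0)$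 are linearly independent. Then: (i) For $\varpi$ as in (Sol2), $D^+_GV(\pi_0;\varpi)$ exists and $$D^+_GV(\pi_0;\varpi)=D_{H,2}f(\underline{x}(\pi_0),\pi_0)\cdot\varpi+\sum_{i=1}^k\lambda_i(\pi_0)D_{H,2}g_i(\underline{x}(\pi_0),\pi_0)\cdot\varpi+\sum_{j=1}^\ell\mu_j(\pi_0)D_{H,2}h_j(\underline{x}(\pi_0),\pi_0)\cdot\varpi,$$ where $\lambda_1(\pi_0),\dots,\lambda_k(\pi_0),\mu_1(\pi_0),\dots,\mu_\ell(\pi_0)$ are the Karush-Kuhn-Tucker multipliers associated to the solution $\underline{x}(\pi_0)$ of $(\mathcal M,\pi_0)$. (ii) If, instead of (Sol2), $D^+_G\underline{x}(\pi_0;\varpi)$ exists for all $\varpi\in Y$, then $V$ is Gâteaux differentiable at $\pi_0$ and $$D_GV(\pi_0)=D_{H,2}f(\underline{x}(\pi_0),\pi_0)+\sum_{i=1}^k\lambda_i(\pi_0)D_{H,2}g_i(\underline{x}(\pi_0),\pi_0)+\sum_{j=1}^\ell\mu_j(\pi_0)D_{H,2}h_j(\underline{x}(\pi_0),\pi_0).$$ (iii) If in addition $D^+_G\underline{x}(\pi;\varpi)$ exists for all $\pi\in P$ and all $\varpi\in Y$, and for every $\psi\in\{f,g_1,\dots,g_k,h_1,\dots,h_\ell\}$ and all $\pi\in P$, $D_H\psi(\underline{x}(\pi),\pi)$ exists and $\pi\mapsto D_{H,2}\psi(\underline{x}(\pi),\pi)$ is continuous on $P$, then $V$ is of class Fréchet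 $C^1$ on an open neighborhood $Q$ of $\pi_0$, and for all $\pi\in Q$, $$D_FV(\pi)=D_{H,2}f(\underline{x}(\pi),\pi)+\sum_{i=1}^k\lambda_i(\pi)D_{H,2}g_i(\underline{x}(\pi),\pi)+\sum_{j=1}^\ell\mu_j(\pi)D_{H,2}h_j(\underline{x}(\pi),\pi),$$ where $\lambda_1(\pi),\dots,\lambda_k(\pi),\mu_1(\pi),\dots,\mu_\ell(\pi)$ are the Karush-Kuhn-Tucker multipliers associated to the solution $\underline{x}(\pi)$ of $(\mathcal M,\pi)$.
   Context: Differentiability. Let $E,F$ be real normed spaces, $U\subset E$ open, $\phi:U\to F$, $x\in U$, $v\in E$. The right directional derivative is $D^+_G\phi(x;v)=\lim_{\theta\to0+}\frac1\theta(\phi(x+\theta v)-\phi(x))$ when it exists. If it exists for all $v$ and $v\mapsto D^+_G\phi(x;v)$ is continuous linear, $\phi$ is Gâteaux differentiable at $x$ and this map is $D_G\phi(x)$. $\phi$ has Hadamard variation $D^+_H\phi(x;v)\in F$ if for all sequences $\theta_n>0$, $\theta_n\to0$, and $v_n\to v$ in $E$, $\frac1{\theta_n}(\phi(x+\theta_nv_n)-\phi(x))\to D^+_H\phi(x;v)$. If it exists for all $v$ and $v\mapsto D^+_H\phi(x;v)$ is continuous linear, this map is the Hadamard differential $D_H\phi(x)$. $D_F$ denotes the Fréchet differential; $C^1$ Fréchet means continuously Fréchet differentiable. $D_{H,1}$, $D_{H,2}$ denote the partial Hadamard differentials with respect to the first and second variable. Dual spaces carry their usual norms. Value: $V(\pi)$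 is the supremum of $f(\cdot,\pi)$ over the admissible points of $(\mathcal M,\pi)$, so $V(\pi)=f(\underline{x}(\pi),\pi)$ for $\pi\in P$. Karush-Kuhn-Tucker multipliers associated to the solution $\underline{x}(\pi)$ of $(\mathcal M,\pi)$: reals $\lambda_1(\pi),\dots,\lambda_k(\pi),\mu_1(\pi),\dots,\mu_\ell(\pi)$ such that $\lambda_i(\pi)\ge0$ and $\lambda_i(\pi)g_i(\underline{x}(\pi),\pi)=0$ for all $i$, and $D_{H,1}f(\underline{x}(\pi),\pi)+\sum_i\lambda_i(\pi)D_{H,1}g_i(\underline{x}(\pi),\pi)+\sum_j\mu_j(\pi)D_{H,1}h_j(\underline{x}(\pi),\pi)=0$ in $X^*$. *)

theory Defs
  imports "HOL-Analysis.Analysis"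
begin

(* Functions whose natural domain is an open set U are represented by total functions.  At a
   point x of U, all differentiability notions below depend only on the values near x. *)

definition has_right_dir_deriv ::
  "('a::real_normed_vector \<Rightarrow> 'b::real_normed_vector) \<Rightarrow> 'a \<Rightarrow> 'a \<Rightarrow> 'b \<Rightarrow> bool" where
  "has_right_dir_deriv \<phi> x v d \<longleftrightarrow>
     ((\<lambda>\<theta>::real. (1 / \<theta>) *\<^sub>R (\<phi> (x + \<theta> *\<^sub>R v) - \<phi> x)) \<longlongrightarrow> d) (at_right 0)"

definition has_gateaux_differential ::
  "('a::real_normed_vector \<Rightarrow> 'b::real_normed_vector) \<Rightarrow> 'a \<Rightarrow> ('a \<Rightarrow>\<^sub>L 'b) \<Rightarrow> bool" where
  "has_gateaux_differential \<phi> x D \<longleftrightarrow> (\<forall>v. has_right_dir_deriv \<phi> x v (blinfun_apply D v))"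

definition has_hadamard_variation ::
  "('a::real_normed_vector \<Rightarrow> 'b::real_normed_vector) \<Rightarrow> 'a \<Rightarrow> 'a \<Rightarrow> 'b \<Rightarrow> bool" where
  "has_hadamard_variation \<phi> x v d \<longleftrightarrow>
     (\<forall>(\<theta>::nat \<Rightarrow> real) w. (\<forall>n. \<theta> n > 0) \<longrightarrow> \<theta> \<longlonglongrightarrow> 0 \<longrightarrow> w \<longlonglongrightarrow> v \<longrightarrow>
        (\<lambda>n. (1 / \<theta> n) *\<^sub>R (\<phi> (x + \<theta> n *\<^sub>R w n) - \<phi> x)) \<longlonglongrightarrow> d)"

definition has_hadamard_differential ::
  "('a::real_normed_vector \<Rightarrow> 'b::real_normed_vector) \<Rightarrow> 'a \<Rightarrow> ('a \<Rightarrow>\<^sub>L 'b) \<Rightarrow> bool" where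
  "has_hadamard_differential \<phi> x D \<longleftrightarrow> (\<forall>v. has_hadamard_variation \<phi> x v (blinfun_apply D v))"

definition hadamard_differentiable ::
  "('a::real_normed_vector \<Rightarrow> 'b::real_normed_vector) \<Rightarrow> 'a \<Rightarrow> bool" where
  "hadamard_differentiable \<phi> x \<longleftrightarrow> (\<exists>D. has_hadamard_differential \<phi> x D)"

(* Meaningful only where hadamard_differentiable holds; then D is unique, see D_H_eqI. *)
definition D_H :: "('a::real_normed_vector \<Rightarrow> 'b::real_normed_vector) \<Rightarrow> 'a \<Rightarrow> ('a \<Rightarrow>\<^sub>L 'b)" where
  "D_H \<phi> x = (THE D. has_hadamard_differential \<phi> x D)"

lemma has_hadamard_differential_unique:
  assumes "has_hadamard_differential \<phi> x D" "has_hadamard_differential \<phi> x D'"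
  shows "D = D'"
proof (rule blinfun_eqI)
  fix v
  let ?q = "\<lambda>n. (1 / inverse (real (Suc n))) *\<^sub>R (\<phi> (x + inverse (real (Suc n)) *\<^sub>R v) - \<phi> x)"
  have *: "?q \<longlonglongrightarrow> blinfun_apply E v" if "has_hadamard_differential \<phi> x E" for E
    using that LIMSEQ_inverse_real_of_nat
    unfolding has_hadamard_differential_def has_hadamard_variation_def
    by (elim allE[of _ v] allE[of _ "\<lambda>n. inverse (real (Suc n))"] allE[of _ "\<lambda>_. v"]) simp
  show "blinfun_apply D v = blinfun_apply D' v"
    using LIMSEQ_unique[OF *[OF assms(1)] *[OF assms(2)]] .
qed

lemma D_H_eqI: "has_hadamard_differential \<phi> x D \<Longrightarrow> D_H \<phi> x = D"
  unfolding D_H_def by (blast intro: has_hadamard_differential_unique)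

definition D_H1 ::
  "('a::real_normed_vector \<times> 'b::real_normed_vector \<Rightarrow> real) \<Rightarrow> 'a \<Rightarrow> 'b \<Rightarrow> ('a \<Rightarrow>\<^sub>L real)" where
  "D_H1 \<psi> x \<pi> = D_H (\<lambda>z. \<psi> (z, \<pi>)) x"

definition D_H2 ::
  "('a::real_normed_vector \<times> 'b::real_normed_vector \<Rightarrow> real) \<Rightarrow> 'a \<Rightarrow> 'b \<Rightarrow> ('b \<Rightarrow>\<^sub>L real)" where
  "D_H2 \<psi> x \<pi> = D_H (\<lambda>\<rho>. \<psi> (x, \<rho>)) \<pi>"

definition is_inner_product :: "('a::real_vector \<Rightarrow> 'a \<Rightarrow> real) \<Rightarrow> bool" where
  "is_inner_product B \<longleftrightarrow>
     bilinear B \<and> (\<forall>u v. B u v = B v u) \<and> (\<forall>u. u \<noteq> 0 \<longrightarrow> B u u > 0)"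

(* Linear independence of an indexed family; unlike independence of its image as a set, it
   forbids repetitions. *)
definition lin_indep_family :: "'i set \<Rightarrow> ('i \<Rightarrow> 'a::real_vector) \<Rightarrow> bool" where
  "lin_indep_family I u \<longleftrightarrow>
     (\<forall>c::'i \<Rightarrow> real. (\<Sum>i\<in>I. c i *\<^sub>R u i) = 0 \<longrightarrow> (\<forall>i\<in>I. c i = 0))"

(* The inequality constraints are g 1, ..., g k and the equality constraints h 1, ..., h l;
   either list may be empty, and values of g and h at other indices play no role. *)

definition admissible ::
  "'a set \<Rightarrow> nat \<Rightarrow> (nat \<Rightarrow> 'a \<times> 'b \<Rightarrow> real) \<Rightarrow> nat \<Rightarrow> (nat \<Rightarrow> 'a \<times> 'b \<Rightarrow> real) \<Rightarrow> 'b \<Rightarrow> 'a set" where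
  "admissible G k g l h \<pi> =
     {x \<in> G. (\<forall>i\<in>{1..k}. g i (x, \<pi>) \<ge> 0) \<and> (\<forall>j\<in>{1..l}. h j (x, \<pi>) = 0)}"

definition is_solution ::
  "'a set \<Rightarrow> ('a \<times> 'b \<Rightarrow> real) \<Rightarrow> nat \<Rightarrow> (nat \<Rightarrow> 'a \<times> 'b \<Rightarrow> real) \<Rightarrow> nat \<Rightarrow> (nat \<Rightarrow> 'a \<times> 'b \<Rightarrow> real)
    \<Rightarrow> 'b \<Rightarrow> 'a \<Rightarrow> bool" where
  "is_solution G f k g l h \<pi> x \<longleftrightarrow>
     x \<in> admissible G k g l h \<pi> \<and> (\<forall>z\<in>admissible G k g l h \<pi>. f (z, \<pi>) \<le> f (x, \<pi>))"

(* A real supremum: unspecified where the problem is infeasible or unbounded, and equal to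
   f (x, \<pi>) whenever the problem has a solution x. *)
definition problem_value ::
  "'a set \<Rightarrow> ('a \<times> 'b \<Rightarrow> real) \<Rightarrow> nat \<Rightarrow> (nat \<Rightarrow> 'a \<times> 'b \<Rightarrow> real) \<Rightarrow> nat \<Rightarrow> (nat \<Rightarrow> 'a \<times> 'b \<Rightarrow> real)
    \<Rightarrow> 'b \<Rightarrow> real" where
  "problem_value G f k g l h \<pi> = (SUP x\<in>admissible G k g l h \<pi>. f (x, \<pi>))"

definition KKT_multipliers ::
  "('a::real_normed_vector \<times> 'b::real_normed_vector \<Rightarrow> real) \<Rightarrow> nat \<Rightarrow> (nat \<Rightarrow> 'a \<times> 'b \<Rightarrow> real) \<Rightarrow>
    nat \<Rightarrow> (nat \<Rightarrow> 'a \<times> 'b \<Rightarrow> real) \<Rightarrow> 'a \<Rightarrow> 'b \<Rightarrow> (nat \<Rightarrow> real) \<Rightarrow> (nat \<Rightarrow> real) \<Rightarrow> bool" where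
  "KKT_multipliers f k g l h x \<pi> lam mu \<longleftrightarrow>
     (\<forall>i\<in>{1..k}. lam i \<ge> 0 \<and> lam i * g i (x, \<pi>) = 0) \<and>
     D_H1 f x \<pi> + (\<Sum>i=1..k. lam i *\<^sub>R D_H1 (g i) x \<pi>) + (\<Sum>j=1..l. mu j *\<^sub>R D_H1 (h j) x \<pi>) = 0"

(* lam and mu are the only multipliers, up to their irrelevant values at indices outside
   {1..k} and {1..l}. *)
definition unique_KKT_multipliers ::
  "('a::real_normed_vector \<times> 'b::real_normed_vector \<Rightarrow> real) \<Rightarrow> nat \<Rightarrow> (nat \<Rightarrow> 'a \<times> 'b \<Rightarrow> real) \<Rightarrow>
    nat \<Rightarrow> (nat \<Rightarrow> 'a \<times> 'b \<Rightarrow> real) \<Rightarrow> 'a \<Rightarrow> 'b \<Rightarrow> (nat \<Rightarrow> real) \<Rightarrow> (nat \<Rightarrow> real) \<Rightarrow> bool" where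
  "unique_KKT_multipliers f k g l h x \<pi> lam mu \<longleftrightarrow>
     KKT_multipliers f k g l h x \<pi> lam mu \<and>
     (\<forall>lam' mu'. KKT_multipliers f k g l h x \<pi> lam' mu' \<longrightarrow>
        (\<forall>i\<in>{1..k}. lam' i = lam i) \<and> (\<forall>j\<in>{1..l}. mu' j = mu j))"

end

theory Submission
  imports Defs
begin

text \<open>
  At a point where the constraint gradients are linearly independent, fix vectors \<open>e\<^sub>s\<close> dual to them.
  Miranda's theorem, applied in the span of the \<open>e\<^sub>s\<close> belonging to the equality constraints, bends
  every direction tangent to these constraints into a sequence of points satisfying them exactly; hence
  the derivative of \<open>f\<close> is nonpositive along feasible directions, and the multipliers are the values
  of \<open>- D f\<close> on the \<open>e\<^sub>s\<close>. The same dual vectors bound the multipliers at nearby parameters, which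
  makes the multipliers continuous there.
  For the value function, \<open>V(\<pi>) = f(x(\<pi>), \<pi>)\<close> is differentiated by the chain rule and \<open>D\<^sub>1 f\<close> is
  eliminated with the multiplier equation: equality constraints vanish identically along the
  ray, and an inequality constraint with positive multiplier stays active along it because its
  multiplier stays positive.
\<close>

section \<open>Miranda's theorem on a cube of variable dimension\<close>

text \<open>The dimension \<open>n\<close> is a number and not a type, since it will be the number
  of equality constraints. Pinning the coordinates from \<open>n\<close> on to 0 makes the set
  compact in the product topology on \<open>nat \<Rightarrow> real\<close>.\<close>

definition cube :: "nat \<Rightarrow> (nat \<Rightarrow> real) set" where
  "cube n = (\<Pi>\<^sub>E i\<in>UNIV. if i < n then {-1..1} else {0})"

lemma compact_cube: "compact (cube n)"
proof -
  have "compactin (product_topology (\<lambda>i. euclidean) UNIV) (cube n)"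
    unfolding cube_def by (subst compactin_PiE) auto
  then show ?thesis
    by (simp add: euclidean_product_topology)
qed

lemma mem_cube: "x \<in> cube n \<longleftrightarrow> (\<forall>i<n. \<bar>x i\<bar> \<le> 1) \<and> (\<forall>i\<ge>n. x i = 0)"
proof -
  have "x \<in> cube n \<longleftrightarrow> (\<forall>i. (i < n \<longrightarrow> \<bar>x i\<bar> \<le> 1) \<and> (i \<ge> n \<longrightarrow> x i = 0))"
    unfolding cube_def PiE_UNIV_domain Pi_iff by (simp add: abs_le_iff minus_le_iff conj_commute not_less)
  then show ?thesis by blast
qed

lemma tendsto_fun_coordinatewise:
  fixes y :: "'a \<Rightarrow> 'i \<Rightarrow> 'b::topological_space"
  assumes "\<And>i. ((\<lambda>n. y n i) \<longlongrightarrow> z i) F"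
  shows "(y \<longlongrightarrow> z) F"
proof -
  have "limitin (product_topology (\<lambda>i. euclidean) UNIV) y z F"
    using assms by (simp add: limitin_componentwise)
  then show ?thesis
    by (simp add: euclidean_product_topology)
qed

text \<open>The Poincare-Miranda theorem. Kuhn's combinatorial lemma, applied on ever finer grids
  with labels given by the signs of the \<open>F i\<close>, yields cells in which every
  \<open>F i\<close> is nonpositive at one corner and nonnegative at another. By compactness a
  subsequence of these cells shrinks to a point, where continuity forces every \<open>F i\<close> to
  vanish.\<close>

lemma cube_common_zero:
  fixes F :: "nat \<Rightarrow> (nat \<Rightarrow> real) \<Rightarrow> real"
  assumes cont: "\<And>i. i < n \<Longrightarrow> continuous_on (cube n) (F i)"
    and low: "\<And>i x. i < n \<Longrightarrow> x \<in> cube n \<Longrightarrow> x i = -1 \<Longrightarrow> F i x < 0"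
    and high: "\<And>i x. i < n \<Longrightarrow> x \<in> cube n \<Longrightarrow> x i = 1 \<Longrightarrow> F i x > 0"
  shows "\<exists>x\<in>cube n. \<forall>i<n. F i x = 0"
proof -
  \<comment> \<open>\<open>pt p\<close> scales an integer grid with \<open>Suc p\<close> steps per
    side onto the cube, sending 0 to -1 and \<open>Suc p\<close> to 1. The mesh is
    \<open>2 / Suc p\<close>; \<open>Suc\<close> avoids a division by zero at
    \<open>p = 0\<close>.\<close>
  define pt :: "nat \<Rightarrow> (nat \<Rightarrow> nat) \<Rightarrow> nat \<Rightarrow> real" where
    "pt p q i = (if i < n then 2 * real (q i) / real (Suc p) - 1 else 0)" for p q i
  have pt_cube: "pt p q \<in> cube n" if "\<forall>i<n. q i \<le> Suc p" for p q
    using that by (auto simp: mem_cube pt_def abs_le_iff field_simps)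
  have "\<exists>q. (\<forall>i<n. q i < Suc p) \<and>
      (\<forall>i<n. \<exists>r s. (\<forall>j<n. q j \<le> r j \<and> r j \<le> q j + 1) \<and> (\<forall>j<n. q j \<le> s j \<and> s j \<le> q j + 1) \<and>
         F i (pt p r) \<le> 0 \<and> F i (pt p s) \<ge> 0)" (is "\<exists>q. ?Q p q") for p
  proof -
    \<comment> \<open>The strict signs on the faces give the boundary labels 0 and 1 that
      \<open>kuhn_lemma\<close> demands. The value 0 gets label 0, so two corners with different
      labels carry weakly opposite signs.\<close>
    define label :: "(nat \<Rightarrow> nat) \<Rightarrow> nat \<Rightarrow> nat" where
      "label q i = (if F i (pt p q) \<le> 0 then 0 else 1)" for q i
    obtain q where q: "\<forall>i<n. q i < Suc p"
      "\<forall>i<n. \<exists>r s. (\<forall>j<n. q j \<le> r j \<and> r j \<le> q j + 1) \<and>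
         (\<forall>j<n. q j \<le> s j \<and> s j \<le> q j + 1) \<and> label r i \<noteq> label s i"
    proof (rule kuhn_lemma[of "Suc p" n label])
      show "\<forall>x. (\<forall>i<n. x i \<le> Suc p) \<longrightarrow> (\<forall>i<n. x i = 0 \<longrightarrow> label x i = 0)"
      proof (intro allI impI)
        fix x i assume x: "\<forall>i<n. x i \<le> Suc p" "i < n" "x i = 0"
        have "F i (pt p x) < 0"
          using x by (intro low pt_cube) (auto simp: pt_def)
        then show "label x i = 0" by (simp add: label_def)
      qed
      show "\<forall>x. (\<forall>i<n. x i \<le> Suc p) \<longrightarrow> (\<forall>i<n. x i = Suc p \<longrightarrow> label x i = 1)"
      proof (intro allI impI)
        fix x i assume x: "\<forall>i<n. x i \<le> Suc p" "i < n" "x i = Suc p"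
        have "F i (pt p x) > 0"
          using x by (intro high pt_cube) (auto simp: pt_def field_simps)
        then show "label x i = 1" by (simp add: label_def)
      qed
    qed (auto simp: label_def)
    have "\<exists>r s. (\<forall>j<n. q j \<le> r j \<and> r j \<le> q j + 1) \<and> (\<forall>j<n. q j \<le> s j \<and> s j \<le> q j + 1) \<and>
         F i (pt p r) \<le> 0 \<and> F i (pt p s) \<ge> 0" if i: "i < n" for i
    proof -
      obtain r s where rs: "\<forall>j<n. q j \<le> r j \<and> r j \<le> q j + 1"
        "\<forall>j<n. q j \<le> s j \<and> s j \<le> q j + 1" "label r i \<noteq> label s i"
        using q(2) i by blast
      show ?thesis
      proof (cases "F i (pt p r) \<le> 0")
        case True
        then show ?thesis using rs by (intro exI[of _ r] exI[of _ s]) (auto simp: label_def split: if_splits)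
      next
        case False
        then show ?thesis using rs by (intro exI[of _ s] exI[of _ r]) (auto simp: label_def split: if_splits)
      qed
    qed
    then show ?thesis using q(1) by blast
  qed
  then have "\<exists>q. \<forall>p. ?Q p (q p)"
    by (intro choice allI)
  then obtain q where q: "\<And>p. ?Q p (q p)"
    by blast
  have q_less: "q p i < Suc p" if "i < n" for p i
    using q[of p] that by blast
  have "\<forall>p. pt p (q p) \<in> cube n"
    using q_less by (simp add: pt_cube less_imp_le)
  with compact_imp_seq_compact[OF compact_cube[of n]]
  obtain z \<sigma> where z: "z \<in> cube n" "strict_mono \<sigma>" "((\<lambda>p. pt p (q p)) \<circ> \<sigma>) \<longlonglongrightarrow> z"
    by (rule seq_compactE)
  have zc: "(\<lambda>p. pt (\<sigma> p) (q (\<sigma> p)) i) \<longlonglongrightarrow> z i" for i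
    using continuous_on_tendsto_compose[OF continuous_on_product_coordinates z(3)]
    by (simp add: o_def)
  have step: "(\<lambda>p. 2 / real (Suc (\<sigma> p))) \<longlonglongrightarrow> 0"
    using LIMSEQ_subseq_LIMSEQ[OF lim_const_over_n[of "2::real", THEN LIMSEQ_Suc] z(2)]
    by (simp add: o_def)
  \<comment> \<open>Any choice of corners \<open>r p\<close> of the selected cells converges to the
    same \<open>z\<close>, because each coordinate is within one mesh width of the base corner
    \<open>q\<close>. The nonpositive and the nonnegative corners then give the two inequalities at
    \<open>z\<close>.\<close>
  have lim: "(\<lambda>p. F i (pt (\<sigma> p) (r p))) \<longlonglongrightarrow> F i z"
    if i: "i < n" and r: "\<And>p. \<forall>j<n. q (\<sigma> p) j \<le> r p j \<and> r p j \<le> q (\<sigma> p) j + 1" for i r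
  proof (rule continuous_on_tendsto_compose[OF cont[OF i] _ z(1)])
    show "\<forall>\<^sub>F p in sequentially. pt (\<sigma> p) (r p) \<in> cube n"
    proof (intro always_eventually allI pt_cube impI)
      fix p j assume "j < n"
      then have "q (\<sigma> p) j < Suc (\<sigma> p)" "r p j \<le> q (\<sigma> p) j + 1"
        using q_less r[of p] by blast+
      then show "r p j \<le> Suc (\<sigma> p)" by simp
    qed
    show "(\<lambda>p. pt (\<sigma> p) (r p)) \<longlonglongrightarrow> z"
    proof (rule tendsto_fun_coordinatewise)
      fix j
      have "\<bar>pt (\<sigma> p) (r p) j - pt (\<sigma> p) (q (\<sigma> p)) j\<bar> \<le> 2 / real (Suc (\<sigma> p))" for p
      proof (cases "j < n")
        case True
        then have "q (\<sigma> p) j \<le> r p j" "r p j \<le> q (\<sigma> p) j + 1"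
          using r[of p] by blast+
        then have "real (q (\<sigma> p) j) \<le> real (r p j)" "real (r p j) \<le> real (q (\<sigma> p) j) + 1"
          by linarith+
        then have "2 * real (q (\<sigma> p) j) / Suc (\<sigma> p) \<le> 2 * real (r p j) / Suc (\<sigma> p)"
           "2 * real (r p j) / Suc (\<sigma> p) \<le> (2 * real (q (\<sigma> p) j) + 2) / Suc (\<sigma> p)"
          by (intro divide_right_mono; linarith)+
        then show ?thesis using True
          by (simp add: pt_def add_divide_distrib abs_le_iff del: of_nat_Suc)
      qed (auto simp: pt_def)
      then have "(\<lambda>p. pt (\<sigma> p) (r p) j - pt (\<sigma> p) (q (\<sigma> p)) j) \<longlonglongrightarrow> 0"
        by (intro Lim_null_comparison[OF _ step]) auto
      from tendsto_add[OF this zc[of j]] show "(\<lambda>p. pt (\<sigma> p) (r p) j) \<longlonglongrightarrow> z j" by simp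
    qed
  qed
  have "F i z = 0" if i: "i < n" for i
  proof (rule antisym)
    have "\<exists>r. (\<forall>j<n. q (\<sigma> p) j \<le> r j \<and> r j \<le> q (\<sigma> p) j + 1) \<and> F i (pt (\<sigma> p) r) \<le> 0" for p
      using q[of "\<sigma> p"] i by blast
    then have "\<exists>r. \<forall>p. (\<forall>j<n. q (\<sigma> p) j \<le> r p j \<and> r p j \<le> q (\<sigma> p) j + 1) \<and>
        F i (pt (\<sigma> p) (r p)) \<le> 0"
      by (intro choice allI)
    then obtain r where r: "\<And>p. \<forall>j<n. q (\<sigma> p) j \<le> r p j \<and> r p j \<le> q (\<sigma> p) j + 1"
      "\<And>p. F i (pt (\<sigma> p) (r p)) \<le> 0"
      by blast
    show "F i z \<le> 0"
      using LIMSEQ_le_const2[OF lim[OF i r(1)]] r(2) by blast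
    have "\<exists>s. (\<forall>j<n. q (\<sigma> p) j \<le> s j \<and> s j \<le> q (\<sigma> p) j + 1) \<and> F i (pt (\<sigma> p) s) \<ge> 0" for p
      using q[of "\<sigma> p"] i by blast
    then have "\<exists>s. \<forall>p. (\<forall>j<n. q (\<sigma> p) j \<le> s p j \<and> s p j \<le> q (\<sigma> p) j + 1) \<and>
        F i (pt (\<sigma> p) (s p)) \<ge> 0"
      by (intro choice allI)
    then obtain s where s: "\<And>p. \<forall>j<n. q (\<sigma> p) j \<le> s p j \<and> s p j \<le> q (\<sigma> p) j + 1"
      "\<And>p. F i (pt (\<sigma> p) (s p)) \<ge> 0"
      by blast
    show "F i z \<ge> 0"
      using LIMSEQ_le_const[OF lim[OF i s(1)]] s(2) by blast
  qed
  with z(1) show ?thesis by blast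
qed

section \<open>Independent functionals and stability of multipliers\<close>

lemma lin_indep_family_insertD:
  assumes "lin_indep_family (insert i I) u" "finite I" "i \<notin> I"
  shows "lin_indep_family I u"
  unfolding lin_indep_family_def
proof (intro allI impI)
  fix c :: "_ \<Rightarrow> real" assume c: "(\<Sum>j\<in>I. c j *\<^sub>R u j) = 0"
  have "(\<Sum>j\<in>I. (c(i := 0)) j *\<^sub>R u j) = (\<Sum>j\<in>I. c j *\<^sub>R u j)"
    using assms(3) by (intro sum.cong) auto
  then have "(\<Sum>j\<in>insert i I. (c(i := 0)) j *\<^sub>R u j) = 0"
    using assms(2,3) c by simp
  then have "\<forall>j\<in>insert i I. (c(i := 0)) j = 0"
    using assms(1) unfolding lin_indep_family_def by blast
  then show "\<forall>j\<in>I. c j = 0"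
    using assms(3) by (metis fun_upd_other insertCI)
qed

text \<open>Induction on the index set: the new functional cannot vanish on the common kernel of the
  earlier ones, for it would then be a combination of them. A vector of that kernel, normalised, is
  the new dual vector and serves to correct the old ones.\<close>

lemma lin_indep_family_dual_basis:
  fixes u :: "'i \<Rightarrow> ('a::real_normed_vector \<Rightarrow>\<^sub>L real)"
  assumes "finite I" "lin_indep_family I u"
  shows "\<exists>e. \<forall>i\<in>I. \<forall>j\<in>I. blinfun_apply (u i) (e j) = (if i = j then 1 else 0)"
  using assms
proof (induction I rule: finite_induct)
  case (insert i I)
  obtain e where e: "\<And>i j. i \<in> I \<Longrightarrow> j \<in> I \<Longrightarrow> blinfun_apply (u i) (e j) = (if i = j then 1 else 0)"
    using insert.IH lin_indep_family_insertD[OF insert.prems insert.hyps] by blast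
  have "\<exists>z. (\<forall>j\<in>I. blinfun_apply (u j) z = 0) \<and> blinfun_apply (u i) z \<noteq> 0"
  proof (rule ccontr)
    assume no: "\<not> ?thesis"
    \<comment> \<open>Subtracting from \<open>y\<close> its components along the \<open>e j\<close>
      leaves a vector in the common kernel, where \<open>u i\<close> vanishes by
      \<open>no\<close>.\<close>
    have "u i = (\<Sum>j\<in>I. blinfun_apply (u i) (e j) *\<^sub>R u j)"
    proof (rule blinfun_eqI)
      fix y
      have "blinfun_apply (u m) (y - (\<Sum>j\<in>I. blinfun_apply (u j) y *\<^sub>R e j)) = 0" if "m \<in> I" for m
        using that insert.hyps(1)
        by (simp add: blinfun.diff_right blinfun.sum_right blinfun.scaleR_right e if_distrib
            cong: if_cong)
      then have "blinfun_apply (u i) (y - (\<Sum>j\<in>I. blinfun_apply (u j) y *\<^sub>R e j)) = 0"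
        using no by blast
      then show "blinfun_apply (u i) y = blinfun_apply (\<Sum>j\<in>I. blinfun_apply (u i) (e j) *\<^sub>R u j) y"
        by (simp add: blinfun.diff_right blinfun.sum_right blinfun.scaleR_right
            blinfun.sum_left blinfun.scaleR_left mult.commute)
    qed
    moreover have "(\<Sum>j\<in>I. ((\<lambda>j. - blinfun_apply (u i) (e j))(i := 1)) j *\<^sub>R u j)
        = (\<Sum>j\<in>I. (- blinfun_apply (u i) (e j)) *\<^sub>R u j)"
      using insert.hyps(2) by (intro sum.cong) auto
    ultimately have "(\<Sum>j\<in>insert i I. ((\<lambda>j. - blinfun_apply (u i) (e j))(i := 1)) j *\<^sub>R u j) = 0"
      using insert.hyps by (simp add: sum_negf)
    then have "((\<lambda>j. - blinfun_apply (u i) (e j))(i := 1)) i = 0"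
      using insert.prems unfolding lin_indep_family_def by blast
    then show False by simp
  qed
  then obtain z where z: "\<And>j. j \<in> I \<Longrightarrow> blinfun_apply (u j) z = 0" "blinfun_apply (u i) z \<noteq> 0"
    by blast
  define z' where "z' = z /\<^sub>R blinfun_apply (u i) z"
  have z': "\<And>j. j \<in> I \<Longrightarrow> blinfun_apply (u j) z' = 0" "blinfun_apply (u i) z' = 1"
    using z by (simp_all add: z'_def blinfun.scaleR_right)
  \<comment> \<open>The correction by \<open>z'\<close> kills \<open>u i\<close> on the old dual
    vectors and leaves the other functionals unchanged, since they vanish at
    \<open>z'\<close>.\<close>
  define e' where "e' = (\<lambda>j. e j - blinfun_apply (u i) (e j) *\<^sub>R z')(i := z')"
  have "blinfun_apply (u m) (e' j) = (if m = j then 1 else 0)"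
    if "m \<in> insert i I" "j \<in> insert i I" for m j
    using that insert.hyps(2) z' e
    by (auto simp: e'_def blinfun.diff_right blinfun.scaleR_right)
  then show ?case by blast
qed simp

text \<open>The matrix of the \<open>U i\<close> on the \<open>e j\<close> is entrywise so close to
  the identity that it stays invertible with a uniform bound: each \<open>c j\<close> is the value
  of the combination at \<open>e j\<close> up to an error that can be absorbed.\<close>

lemma dual_basis_perturbation_bound:
  fixes U :: "'i \<Rightarrow> ('a::real_normed_vector \<Rightarrow>\<^sub>L real)"
  assumes fin: "finite I"
    and near: "\<And>i j. i \<in> I \<Longrightarrow> j \<in> I \<Longrightarrow>
      \<bar>blinfun_apply (U i) (e j) - (if i = j then 1 else 0)\<bar> \<le> 1 / (2 * real (card I))"
  shows "(\<Sum>j\<in>I. \<bar>c j\<bar>) \<le> 2 * (\<Sum>j\<in>I. \<bar>blinfun_apply (\<Sum>i\<in>I. c i *\<^sub>R U i) (e j)\<bar>)"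
proof (cases "I = {}")
  case False
  let ?A = "\<lambda>j. blinfun_apply (\<Sum>i\<in>I. c i *\<^sub>R U i) (e j)"
  have "\<bar>c j\<bar> \<le> \<bar>?A j\<bar> + (\<Sum>i\<in>I. \<bar>c i\<bar>) * (1 / (2 * real (card I)))" if j: "j \<in> I" for j
  proof -
    have "c j = (\<Sum>i\<in>I. c i * (if i = j then 1 else 0))"
      using fin j by (simp add: if_distrib cong: if_cong)
    then have "c j = ?A j - (\<Sum>i\<in>I. c i * (blinfun_apply (U i) (e j) - (if i = j then 1 else 0)))"
      by (simp add: blinfun.sum_left blinfun.scaleR_left right_diff_distrib sum_subtractf)
    moreover have "\<bar>\<Sum>i\<in>I. c i * (blinfun_apply (U i) (e j) - (if i = j then 1 else 0))\<bar>
        \<le> (\<Sum>i\<in>I. \<bar>c i\<bar> * (1 / (2 * real (card I))))"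
      using near j by (intro order_trans[OF sum_abs] sum_mono) (simp add: abs_mult mult_left_mono del: times_divide_eq_right)
    ultimately show ?thesis
      unfolding sum_distrib_right by linarith
  qed
  then have "(\<Sum>j\<in>I. \<bar>c j\<bar>) \<le> (\<Sum>j\<in>I. \<bar>?A j\<bar> + (\<Sum>i\<in>I. \<bar>c i\<bar>) * (1 / (2 * real (card I))))"
    by (rule sum_mono)
  \<comment> \<open>Summing the error over \<open>card I\<close> indices leaves half of the
    left-hand side, which is absorbed there and produces the factor 2.\<close>
  also have "\<dots> = (\<Sum>j\<in>I. \<bar>?A j\<bar>) + (\<Sum>i\<in>I. \<bar>c i\<bar>) / 2"
    using False fin by (simp add: sum.distrib)
  finally show ?thesis by simp
qed simp

text \<open>The vectors \<open>e\<close> are dual to the limit family and stay fixed; only finitely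
  many evaluations have to converge.\<close>

lemma eventually_dual_basis_near:
  fixes U :: "'c \<Rightarrow> 'i \<Rightarrow> ('a::real_normed_vector \<Rightarrow>\<^sub>L real)"
  assumes fin: "finite I"
    and lim: "\<And>i. i \<in> I \<Longrightarrow> ((\<lambda>\<pi>. U \<pi> i) \<longlongrightarrow> U0 i) F"
    and e: "\<And>i j. i \<in> I \<Longrightarrow> j \<in> I \<Longrightarrow> blinfun_apply (U0 i) (e j) = (if i = j then 1 else 0)"
  shows "\<forall>\<^sub>F \<pi> in F. \<forall>i\<in>I. \<forall>j\<in>I.
    \<bar>blinfun_apply (U \<pi> i) (e j) - (if i = j then 1 else 0)\<bar> \<le> 1 / (2 * real (card I))"
proof -
  have "\<forall>\<^sub>F \<pi> in F. \<bar>blinfun_apply (U \<pi> i) (e j) - (if i = j then 1 else 0)\<bar> \<le> 1 / (2 * real (card I))"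
    if ij: "i \<in> I" "j \<in> I" for i j
  proof -
    have "((\<lambda>\<pi>. blinfun_apply (U \<pi> i) (e j)) \<longlongrightarrow> (if i = j then 1 else 0)) F"
      using blinfun.tendsto[OF lim[OF ij(1)] tendsto_const[of "e j"]] e[OF ij] by simp
    moreover have "1 / (2 * real (card I)) > 0"
      using fin ij by (auto simp: card_gt_0_iff)
    ultimately have "\<forall>\<^sub>F \<pi> in F. dist (blinfun_apply (U \<pi> i) (e j)) (if i = j then 1 else 0)
        < 1 / (2 * real (card I))"
      by (rule tendstoD)
    then show ?thesis
      by eventually_elim (simp only: dist_real_def less_imp_le)
  qed
  then show ?thesis
    using fin by (simp add: eventually_ball_finite_distrib)
qed

text \<open>The perturbation bound, applied to a vanishing combination, forces all its coefficients
  to be 0.\<close>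

lemma eventually_lin_indep_family:
  fixes U :: "'c \<Rightarrow> 'i \<Rightarrow> ('a::real_normed_vector \<Rightarrow>\<^sub>L real)"
  assumes fin: "finite I"
    and lim: "\<And>i. i \<in> I \<Longrightarrow> ((\<lambda>\<pi>. U \<pi> i) \<longlongrightarrow> U0 i) F"
    and indep: "lin_indep_family I U0"
  shows "\<forall>\<^sub>F \<pi> in F. lin_indep_family I (U \<pi>)"
proof -
  obtain e where e: "\<And>i j. i \<in> I \<Longrightarrow> j \<in> I \<Longrightarrow> blinfun_apply (U0 i) (e j) = (if i = j then 1 else 0)"
    using lin_indep_family_dual_basis[OF fin indep] by blast
  have near: "\<forall>\<^sub>F \<pi> in F. \<forall>i\<in>I. \<forall>j\<in>I.
      \<bar>blinfun_apply (U \<pi> i) (e j) - (if i = j then 1 else 0)\<bar> \<le> 1 / (2 * real (card I))"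
    using fin lim e by (rule eventually_dual_basis_near)
  then show ?thesis
  proof eventually_elim
    case (elim \<pi>)
    show ?case unfolding lin_indep_family_def
    proof (intro allI impI)
      fix c :: "'i \<Rightarrow> real" assume "(\<Sum>i\<in>I. c i *\<^sub>R U \<pi> i) = 0"
      then have "(\<Sum>j\<in>I. \<bar>c j\<bar>) \<le> 0"
        using dual_basis_perturbation_bound[OF fin, of "U \<pi>" e c] elim by simp
      then have "(\<Sum>j\<in>I. \<bar>c j\<bar>) = 0"
        by (intro antisym sum_nonneg) auto
      then show "\<forall>i\<in>I. c i = 0"
        using fin by (simp add: sum_nonneg_eq_0_iff)
    qed
  qed
qed

text \<open>The perturbation bound is applied to the differences \<open>c \<pi> i - c0 i\<close>.
  Their combination of the \<open>U \<pi> i\<close> is minus the residual left by the limit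
  coefficients \<open>c0\<close> in the perturbed equation, and this residual tends to 0.\<close>

lemma tendsto_multipliers:
  fixes U :: "'c \<Rightarrow> 'i \<Rightarrow> ('a::real_normed_vector \<Rightarrow>\<^sub>L real)"
  assumes fin: "finite I"
    and lim: "\<And>i. i \<in> I \<Longrightarrow> ((\<lambda>\<pi>. U \<pi> i) \<longlongrightarrow> U0 i) F"
    and limA: "(A \<longlongrightarrow> A0) F"
    and indep: "lin_indep_family I U0"
    and c0: "A0 + (\<Sum>i\<in>I. c0 i *\<^sub>R U0 i) = 0"
    and c: "\<forall>\<^sub>F \<pi> in F. A \<pi> + (\<Sum>i\<in>I. c \<pi> i *\<^sub>R U \<pi> i) = 0"
    and m: "m \<in> I"
  shows "((\<lambda>\<pi>. c \<pi> m) \<longlongrightarrow> c0 m) F"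
proof -
  obtain e where e: "\<And>i j. i \<in> I \<Longrightarrow> j \<in> I \<Longrightarrow> blinfun_apply (U0 i) (e j) = (if i = j then 1 else 0)"
    using lin_indep_family_dual_basis[OF fin indep] by blast
  have near: "\<forall>\<^sub>F \<pi> in F. \<forall>i\<in>I. \<forall>j\<in>I.
      \<bar>blinfun_apply (U \<pi> i) (e j) - (if i = j then 1 else 0)\<bar> \<le> 1 / (2 * real (card I))"
    using fin lim e by (rule eventually_dual_basis_near)
  let ?R = "\<lambda>\<pi>. A \<pi> + (\<Sum>i\<in>I. c0 i *\<^sub>R U \<pi> i)"
  have "(?R \<longlongrightarrow> A0 + (\<Sum>i\<in>I. c0 i *\<^sub>R U0 i)) F"
    using lim by (intro tendsto_intros limA) auto
  then have "((\<lambda>\<pi>. 2 * (\<Sum>j\<in>I. \<bar>blinfun_apply (?R \<pi>) (e j)\<bar>)) \<longlongrightarrow> 2 * (\<Sum>j\<in>I. \<bar>blinfun_apply 0 (e j)\<bar>)) F"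
    unfolding c0 by (intro tendsto_intros)
  then have R0: "((\<lambda>\<pi>. 2 * (\<Sum>j\<in>I. \<bar>blinfun_apply (?R \<pi>) (e j)\<bar>)) \<longlongrightarrow> 0) F"
    by simp
  have "\<forall>\<^sub>F \<pi> in F. norm (c \<pi> m - c0 m) \<le> 2 * (\<Sum>j\<in>I. \<bar>blinfun_apply (?R \<pi>) (e j)\<bar>)"
    using near c
  proof eventually_elim
    case (elim \<pi>)
    have eq: "(\<Sum>i\<in>I. (c \<pi> i - c0 i) *\<^sub>R U \<pi> i) = - ?R \<pi>"
      using elim(2) by (simp add: scaleR_diff_left sum_subtractf eq_neg_iff_add_eq_0 add.commute)
    have "(\<Sum>i\<in>I. \<bar>c \<pi> i - c0 i\<bar>)
        \<le> 2 * (\<Sum>j\<in>I. \<bar>blinfun_apply (\<Sum>i\<in>I. (c \<pi> i - c0 i) *\<^sub>R U \<pi> i) (e j)\<bar>)"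
      using elim(1) by (intro dual_basis_perturbation_bound[OF fin]) blast
    then have "(\<Sum>i\<in>I. \<bar>c \<pi> i - c0 i\<bar>) \<le> 2 * (\<Sum>j\<in>I. \<bar>blinfun_apply (?R \<pi>) (e j)\<bar>)"
      by (simp only: eq blinfun.minus_left abs_minus_cancel)
    moreover have "\<bar>c \<pi> m - c0 m\<bar> \<le> (\<Sum>i\<in>I. \<bar>c \<pi> i - c0 i\<bar>)"
      using fin m by (intro member_le_sum) auto
    ultimately show ?case by simp
  qed
  then have "((\<lambda>\<pi>. c \<pi> m - c0 m) \<longlongrightarrow> 0) F"
    by (rule Lim_null_comparison[OF _ R0])
  then show ?thesis
    by (rule LIM_zero_cancel)
qed

section \<open>Differentiability\<close>

text \<open>The mean value theorem on the segment from \<open>x\<close> to \<open>y\<close> turns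
  the increment of \<open>V\<close> into \<open>V'\<close> at an intermediate point, and continuity
  of \<open>V'\<close> in operator norm bounds the error.\<close>

lemma has_derivative_of_gateaux_continuous:
  fixes V :: "'b::real_normed_vector \<Rightarrow> real"
  assumes Q: "open Q" "x \<in> Q"
    and gat: "\<And>y. y \<in> Q \<Longrightarrow> has_gateaux_differential V y (V' y)"
    and cont: "continuous_on Q V'"
  shows "(V has_derivative blinfun_apply (V' x)) (at x)"
  unfolding has_derivative_at_alt
proof (intro conjI allI impI blinfun.bounded_linear_right)
  fix e :: real assume "e > 0"
  have "\<forall>\<^sub>F y in at x. dist (V' y) (V' x) < e \<and> y \<in> Q"
  proof (intro eventually_conj tendstoD)
    show "V' \<midarrow>x\<rightarrow> V' x"
      using cont Q by (simp add: continuous_on_eq_continuous_at continuous_at)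
    show "\<forall>\<^sub>F y in at x. y \<in> Q"
      using Q by (rule eventually_at_in_open')
  qed (fact \<open>e > 0\<close>)
  then obtain d where d: "d > 0" "\<And>y. dist y x < d \<Longrightarrow> y \<noteq> x \<Longrightarrow> dist (V' y) (V' x) < e \<and> y \<in> Q"
    by (auto simp: eventually_at)
  \<comment> \<open>The punctured filter says nothing about the centre, so the case
    \<open>y = x\<close> is added by hand.\<close>
  then have d': "dist (V' y) (V' x) < e \<and> y \<in> Q" if "dist y x < d" for y
    using that Q(2) \<open>e > 0\<close> by (cases "y = x") auto
  show "\<exists>d>0. \<forall>y. norm (y - x) < d \<longrightarrow>
      norm (V y - V x - blinfun_apply (V' x) (y - x)) \<le> e * norm (y - x)"
  proof (intro exI[of _ d] conjI allI impI d(1))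
    fix y assume y: "norm (y - x) < d"
    define w where "w = y - x"
    have in_ball: "dist (x + t *\<^sub>R w) x < d" if "0 \<le> t" "t \<le> 1" for t
      using y that by (simp add: dist_norm w_def) (meson le_less_trans mult_left_le_one_le norm_ge_zero)
    have "((\<lambda>t. V (x + t *\<^sub>R w)) has_real_derivative blinfun_apply (V' (x + t *\<^sub>R w)) w) (at t)"
      if t: "0 \<le> t" "t \<le> 1" for t
    proof -
      let ?y = "x + t *\<^sub>R w"
      let ?q = "\<lambda>s. (V (x + (t + s) *\<^sub>R w) - V ?y) / s"
      have g: "has_right_dir_deriv V ?y v (blinfun_apply (V' ?y) v)" for v
        using gat d'[OF in_ball[OF t]] unfolding has_gateaux_differential_def by blast
      have "(?q \<longlongrightarrow> blinfun_apply (V' ?y) w) (at_right 0)"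
        using g[of w] by (simp add: has_right_dir_deriv_def scaleR_add_left add.assoc)
      \<comment> \<open>Only right derivatives are given. The left limit comes from the direction
        \<open>- w\<close> after the change of sign of the step, and linearity of \<open>V'\<close>
        makes the two limits agree.\<close>
      moreover have "(?q \<longlongrightarrow> blinfun_apply (V' ?y) w) (at_left 0)"
        using tendsto_minus[OF g[of "- w", unfolded has_right_dir_deriv_def]]
        by (simp add: at_left_minus[of 0] filterlim_filtermap blinfun.minus_right scaleR_diff_left
            add_diff_eq)
      ultimately have "(?q \<longlongrightarrow> blinfun_apply (V' ?y) w) (at 0)"
        by (simp add: filterlim_at_split)
      then show ?thesis
        by (simp add: DERIV_def)
    qed
    from MVT2[of 0 1, OF _ this]
    obtain t where t: "0 < t" "t < 1" "V y - V x = blinfun_apply (V' (x + t *\<^sub>R w)) w"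
      by (auto simp: w_def)
    have "norm (V y - V x - blinfun_apply (V' x) w) = norm (blinfun_apply (V' (x + t *\<^sub>R w) - V' x) w)"
      using t by (simp add: blinfun.diff_left)
    also have "\<dots> \<le> norm (V' (x + t *\<^sub>R w) - V' x) * norm w"
      by (rule norm_blinfun)
    also have "\<dots> \<le> e * norm w"
      using d'[OF in_ball[of t]] t by (intro mult_right_mono) (auto simp: dist_norm)
    finally show "norm (V y - V x - blinfun_apply (V' x) (y - x)) \<le> e * norm (y - x)"
      by (simp add: w_def)
  qed
qed

section \<open>Hadamard quotients along sequences, rays and compact sets of directions\<close>

lemma D_H_works: "hadamard_differentiable \<phi> x \<Longrightarrow> has_hadamard_differential \<phi> x (D_H \<phi> x)"
  by (auto simp: hadamard_differentiable_def D_H_eqI)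

lemma has_hadamard_differential_seqD:
  assumes "has_hadamard_differential \<phi> x D" "\<And>n. \<theta> n > 0" "\<theta> \<longlonglongrightarrow> 0" "w \<longlonglongrightarrow> v"
  shows "(\<lambda>n. (1 / \<theta> n) *\<^sub>R (\<phi> (x + \<theta> n *\<^sub>R w n) - \<phi> x)) \<longlonglongrightarrow> blinfun_apply D v"
  using assms unfolding has_hadamard_differential_def has_hadamard_variation_def by blast

lemma has_hadamard_differential_at_rightD:
  assumes "has_hadamard_differential \<phi> x D" "(w \<longlongrightarrow> v) (at_right 0)"
  shows "((\<lambda>t. (1 / t) *\<^sub>R (\<phi> (x + t *\<^sub>R w t) - \<phi> x)) \<longlongrightarrow> blinfun_apply D v) (at_right 0)"
proof (rule tendsto_at_right_sequentially[of 0 1])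
  fix S :: "nat \<Rightarrow> real" assume S: "\<And>n. 0 < S n" "S \<longlonglongrightarrow> 0"
  then have "filterlim S (at_right 0) sequentially"
    by (intro tendsto_imp_filterlim_at_right) auto
  then have "(\<lambda>n. w (S n)) \<longlonglongrightarrow> v"
    by (rule filterlim_compose[OF assms(2)])
  with S show "(\<lambda>n. (1 / S n) *\<^sub>R (\<phi> (x + S n *\<^sub>R w (S n)) - \<phi> x)) \<longlonglongrightarrow> blinfun_apply D v"
    by (intro has_hadamard_differential_seqD[OF assms(1)])
qed simp

text \<open>If uniformity failed, there would be steps tending to 0 and directions in
  \<open>K\<close> with error at least \<open>e\<close>. Along a convergent subsequence of these
  directions, both the quotients and the values of \<open>D\<close> tend to \<open>D z\<close>, a
  contradiction.\<close>

lemma hadamard_differential_uniform_on_compact: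
  assumes D: "has_hadamard_differential \<phi> x D" and K: "compact K" and "e > 0"
  shows "\<forall>\<^sub>F t in at_right 0. \<forall>w\<in>K.
    norm ((1 / t) *\<^sub>R (\<phi> (x + t *\<^sub>R w) - \<phi> x) - blinfun_apply D w) < e"
proof (rule sequentially_imp_eventually_at_right[of 0 1], simp, rule ccontr)
  fix S :: "nat \<Rightarrow> real" assume S: "\<And>n. 0 < S n" "S \<longlonglongrightarrow> 0"
  let ?q = "\<lambda>t w. (1 / t) *\<^sub>R (\<phi> (x + t *\<^sub>R w) - \<phi> x)"
  assume "\<not> (\<forall>\<^sub>F n in sequentially. \<forall>w\<in>K. norm (?q (S n) w - blinfun_apply D w) < e)"
  from not_eventually_sequentiallyD[OF this]
  obtain r :: "nat \<Rightarrow> nat" where r: "strict_mono r"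
    "\<And>n. \<exists>w\<in>K. \<not> norm (?q (S (r n)) w - blinfun_apply D w) < e"
    by auto
  from r(2) obtain w where w: "\<And>n. w n \<in> K" "\<And>n. \<not> norm (?q (S (r n)) (w n) - blinfun_apply D (w n)) < e"
    by metis
  from compact_imp_seq_compact[OF K] w(1)
  obtain z \<sigma> where z: "strict_mono \<sigma>" "(w \<circ> \<sigma>) \<longlonglongrightarrow> z"
    by (auto elim!: seq_compactE[of K w])
  have "(\<lambda>n. S (r (\<sigma> n))) \<longlonglongrightarrow> 0"
    using LIMSEQ_subseq_LIMSEQ[OF S(2) strict_mono_o[OF r(1) z(1)]] by (simp add: o_def)
  then have 1: "(\<lambda>n. ?q (S (r (\<sigma> n))) (w (\<sigma> n))) \<longlonglongrightarrow> blinfun_apply D z"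
    using S(1) z(2) by (intro has_hadamard_differential_seqD[OF D]) (auto simp: o_def)
  have 2: "(\<lambda>n. blinfun_apply D (w (\<sigma> n))) \<longlonglongrightarrow> blinfun_apply D z"
    using z(2) by (intro blinfun.tendsto tendsto_const) (simp add: o_def)
  from tendstoD[OF tendsto_diff[OF 1 2] \<open>e > 0\<close>]
  have "\<forall>\<^sub>F n in sequentially. False"
    by eventually_elim (use w(2) in simp)
  then show False by simp
qed

lemma eventually_at_right_0_mem_open:
  fixes x :: "'a::real_normed_vector"
  assumes K: "compact K" and N: "open N" "x \<in> N"
  shows "\<forall>\<^sub>F t in at_right 0. \<forall>w\<in>K. x + t *\<^sub>R w \<in> N"
proof -
  obtain M where M: "M > 0" "\<And>w. w \<in> K \<Longrightarrow> norm w \<le> M"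
    using compact_imp_bounded[OF K] by (auto simp: bounded_pos)
  obtain r where r: "r > 0" "ball x r \<subseteq> N"
    using N by (meson open_contains_ball)
  have "\<forall>\<^sub>F t in at_right 0. t \<in> {0<..<r / M}"
    using M r by (intro eventually_at_right_real) simp
  then show ?thesis
  proof eventually_elim
    case (elim t)
    show ?case
    proof
      fix w assume "w \<in> K"
      then have "t * norm w \<le> t * M"
        using M elim by (intro mult_left_mono) auto
      also have "\<dots> < r" using elim M by (simp add: field_simps)
      finally have "x + t *\<^sub>R w \<in> ball x r" using elim by (simp add: dist_norm)
      then show "x + t *\<^sub>R w \<in> N" using r by blast
    qed
  qed
qed

section \<open>Karush-Kuhn-Tucker multipliers\<close>

text \<open>This replaces the implicit function theorem: Miranda's theorem selects a correction of
  the tangent direction \<open>v\<close>, of size proportional to \<open>\<epsilon>\<close>, that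
  makes all the \<open>H j\<close> vanish exactly.\<close>

lemma eventually_zero_near_tangent:
  fixes H :: "nat \<Rightarrow> 'a::real_normed_vector \<Rightarrow> real"
  assumes D: "\<And>j. j < n \<Longrightarrow> has_hadamard_differential (H j) x (u j)"
    and H0: "\<And>j. j < n \<Longrightarrow> H j x = 0"
    and cont: "\<And>j. j < n \<Longrightarrow> \<exists>N. open N \<and> x \<in> N \<and> continuous_on N (H j)"
    and v: "\<And>j. j < n \<Longrightarrow> blinfun_apply (u j) v = 0"
    and e: "\<And>i j. i < n \<Longrightarrow> j < n \<Longrightarrow> blinfun_apply (u i) (e j) = (if i = j then 1 else 0)"
    and "\<epsilon> > 0"
  shows "\<forall>\<^sub>F t in at_right 0. \<exists>c. (\<forall>j<n. \<bar>c j\<bar> \<le> 1) \<and>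
    (\<forall>j<n. H j (x + t *\<^sub>R (v + \<epsilon> *\<^sub>R (\<Sum>i<n. c i *\<^sub>R e i))) = 0)"
proof -
  define W where "W c = v + \<epsilon> *\<^sub>R (\<Sum>i<n. c i *\<^sub>R e i)" for c :: "nat \<Rightarrow> real"
  have contW: "continuous_on (cube n) W"
    unfolding W_def by (intro continuous_intros continuous_on_subset[OF continuous_on_product_coordinates]) auto
  then have K: "compact (W ` cube n)"
    by (rule compact_continuous_image[OF _ compact_cube])
  \<comment> \<open>Since \<open>v\<close> is tangent and the \<open>e i\<close> are dual to the
    \<open>u j\<close>, each \<open>u j\<close> reads off one coordinate of
    \<open>c\<close>.\<close>
  have uW: "blinfun_apply (u j) (W c) = \<epsilon> * c j" if "j < n" for j c
    using that by (simp add: W_def blinfun.add_right blinfun.scaleR_right blinfun.sum_right v e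
        if_distrib cong: if_cong)
  obtain N where N: "\<And>j. j < n \<Longrightarrow> open (N j) \<and> x \<in> N j \<and> continuous_on (N j) (H j)"
    using cont by metis
  have "\<forall>\<^sub>F t in at_right 0. \<forall>j\<in>{..<n}.
      (\<forall>w\<in>W ` cube n. norm ((1 / t) *\<^sub>R (H j (x + t *\<^sub>R w) - H j x) - blinfun_apply (u j) w) < \<epsilon>) \<and>
      (\<forall>w\<in>W ` cube n. x + t *\<^sub>R w \<in> N j)"
    by (intro eventually_ball_finite ballI eventually_conj
        hadamard_differential_uniform_on_compact[OF D K \<open>\<epsilon> > 0\<close>] eventually_at_right_0_mem_open[OF K])
      (use N in auto)
  moreover have "\<forall>\<^sub>F t in at_right (0::real). t > 0"
    by (rule eventually_at_right_less)
  ultimately show ?thesis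
  proof eventually_elim
    case (elim t)
    \<comment> \<open>The error is less than \<open>\<epsilon>\<close>, uniformly over the cube,
      while the linear part equals \<open>\<epsilon>\<close> or \<open>- \<epsilon>\<close> on the
      faces. Hence \<open>H j\<close> has there the sign required by Miranda's theorem.\<close>
    have est: "\<bar>H j (x + t *\<^sub>R W c) / t - \<epsilon> * c j\<bar> < \<epsilon>" if "j < n" "c \<in> cube n" for j c
      using elim that by (auto simp: H0 uW)
    have "\<exists>c\<in>cube n. \<forall>j<n. H j (x + t *\<^sub>R W c) = 0"
    proof (rule cube_common_zero)
      fix j assume j: "j < n"
      have "continuous_on (cube n) (H j \<circ> (\<lambda>c. x + t *\<^sub>R W c))"
        using N[OF j] elim j
        by (intro continuous_on_compose continuous_intros contW) (auto intro: continuous_on_subset)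
      then show "continuous_on (cube n) (\<lambda>c. H j (x + t *\<^sub>R W c))" by (simp add: o_def)
      fix c assume c: "c \<in> cube n"
      show "H j (x + t *\<^sub>R W c) < 0" if "c j = -1"
      proof -
        have "H j (x + t *\<^sub>R W c) / t < 0" using est[OF j c] that by (simp add: abs_less_iff)
        then show ?thesis using elim by (simp add: divide_less_0_iff)
      qed
      show "H j (x + t *\<^sub>R W c) > 0" if "c j = 1"
      proof -
        have "H j (x + t *\<^sub>R W c) / t > 0" using est[OF j c] that by (simp add: abs_less_iff)
        then show ?thesis using elim by (simp add: zero_less_divide_iff)
      qed
    qed
    then obtain c where c: "c \<in> cube n" "\<forall>j<n. H j (x + t *\<^sub>R W c) = 0"
      by blast
    then show ?case
      by (intro exI[of _ c]) (simp add: mem_cube W_def)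
  qed
qed

text \<open>Points that satisfy the equality constraints exactly approach \<open>x\<close> along
  directions tending to \<open>v\<close>. The strict slopes \<open>gv\<close> keep the active
  inequalities satisfied and the inactive ones persist, so the points are eventually admissible and
  the quotients of \<open>f\<close> are nonpositive.\<close>

lemma first_order_necessary_condition:
  fixes f :: "'a::real_normed_vector \<Rightarrow> real" and g h :: "nat \<Rightarrow> 'a \<Rightarrow> real"
  assumes G: "open G" "x \<in> G"
    and g_nonneg: "\<And>i. i \<in> {1..k} \<Longrightarrow> g i x \<ge> 0"
    and h_zero: "\<And>j. j \<in> {1..l} \<Longrightarrow> h j x = 0"
    and max: "\<And>z. z \<in> G \<Longrightarrow> (\<And>i. i \<in> {1..k} \<Longrightarrow> g i z \<ge> 0) \<Longrightarrow>
      (\<And>j. j \<in> {1..l} \<Longrightarrow> h j z = 0) \<Longrightarrow> f z \<le> f x"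
    and Df: "has_hadamard_differential f x Df"
    and Dg: "\<And>i. i \<in> {1..k} \<Longrightarrow> has_hadamard_differential (g i) x (Dg i)"
    and Dh: "\<And>j. j \<in> {1..l} \<Longrightarrow> has_hadamard_differential (h j) x (Dh j)"
    and cont: "\<And>j. j \<in> {1..l} \<Longrightarrow> \<exists>N. open N \<and> x \<in> N \<and> continuous_on N (h j)"
    and e: "\<And>i j. i \<in> {1..l} \<Longrightarrow> j \<in> {1..l} \<Longrightarrow> blinfun_apply (Dh i) (e j) = (if i = j then 1 else 0)"
    and gv: "\<And>i. i \<in> {1..k} \<Longrightarrow> g i x = 0 \<Longrightarrow> blinfun_apply (Dg i) v > 0"
    and hv: "\<And>j. j \<in> {1..l} \<Longrightarrow> blinfun_apply (Dh j) v = 0"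
  shows "blinfun_apply Df v \<le> 0"
proof -
  \<comment> \<open>One tolerance \<open>1 / Suc m\<close> bounds both the step and the size of the
    correction, so that as \<open>m\<close> grows the steps tend to 0 and the corrected directions
    to \<open>v\<close>.\<close>
  have "\<exists>t c. 0 < t \<and> t < 1 / real (Suc m) \<and> (\<forall>j<l. \<bar>c j\<bar> \<le> 1) \<and>
    (\<forall>j<l. h (Suc j) (x + t *\<^sub>R (v + (1 / real (Suc m)) *\<^sub>R (\<Sum>i<l. c i *\<^sub>R e (Suc i)))) = 0)"
    (is "\<exists>t c. ?P m t c") for m
  proof -
    have "\<forall>\<^sub>F t in at_right 0. \<exists>c. (\<forall>j<l. \<bar>c j\<bar> \<le> 1) \<and>
      (\<forall>j<l. h (Suc j) (x + t *\<^sub>R (v + (1 / real (Suc m)) *\<^sub>R (\<Sum>i<l. c i *\<^sub>R e (Suc i)))) = 0)"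
      \<comment> \<open>The constraints are numbered from 1 and the cube coordinates from 0, hence
        the shift by \<open>Suc\<close>.\<close>
      using Dh h_zero cont hv e by (intro eventually_zero_near_tangent[where u = "\<lambda>j. Dh (Suc j)"]) auto
    moreover have "\<forall>\<^sub>F t in at_right 0. t \<in> {0<..<1 / real (Suc m)}"
      by (intro eventually_at_right_real) simp
    ultimately have "\<forall>\<^sub>F t in at_right (0::real). t \<in> {0<..<1 / real (Suc m)} \<and>
      (\<exists>c. (\<forall>j<l. \<bar>c j\<bar> \<le> 1) \<and>
      (\<forall>j<l. h (Suc j) (x + t *\<^sub>R (v + (1 / real (Suc m)) *\<^sub>R (\<Sum>i<l. c i *\<^sub>R e (Suc i)))) = 0))"
      by eventually_elim blast
    from eventually_happens'[OF _ this] show ?thesis by force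
  qed
  then have "\<exists>t. \<forall>m. \<exists>c. ?P m (t m) c"
    by (intro choice allI)
  then obtain t where "\<forall>m. \<exists>c. ?P m (t m) c" ..
  then have "\<exists>c. \<forall>m. ?P m (t m) (c m)"
    by (intro choice allI) blast
  then obtain c where tc: "\<And>m. ?P m (t m) (c m)"
    by blast
  then have t: "\<And>m. 0 < t m" "\<And>m. t m < 1 / real (Suc m)"
    and c: "\<And>m j. j < l \<Longrightarrow> \<bar>c m j\<bar> \<le> 1"
    by blast+
  define w where "w m = v + (1 / real (Suc m)) *\<^sub>R (\<Sum>i<l. c m i *\<^sub>R e (Suc i))" for m
  have inv0: "(\<lambda>m. 1 / real (Suc m)) \<longlonglongrightarrow> 0"
    using LIMSEQ_Suc[OF lim_const_over_n[of "1::real"]] by simp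
  have t0: "t \<longlonglongrightarrow> 0"
    using t by (intro Lim_null_comparison[OF _ inv0] always_eventually allI) (simp add: less_imp_le)
  have bound: "norm (w m - v) \<le> 1 / real (Suc m) * (\<Sum>i<l. norm (e (Suc i)))" for m
  proof -
    have "norm (\<Sum>i<l. c m i *\<^sub>R e (Suc i)) \<le> (\<Sum>i<l. norm (e (Suc i)))"
      using c by (intro sum_norm_le) (simp add: mult_left_le_one_le)
    then show ?thesis
      by (simp add: w_def divide_right_mono)
  qed
  have "(\<lambda>m. w m - v) \<longlonglongrightarrow> 0"
    by (rule Lim_null_comparison[OF always_eventually[OF allI[OF bound]] tendsto_mult_left_zero[OF inv0]])
  then have wv: "w \<longlonglongrightarrow> v" by (rule LIM_zero_cancel)
  have quot: "(\<lambda>m. (\<phi> (x + t m *\<^sub>R w m) - \<phi> x) / t m) \<longlonglongrightarrow> blinfun_apply D v"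
    if "has_hadamard_differential \<phi> x D" for \<phi> D
    using has_hadamard_differential_seqD[OF that t(1) t0 wv] by simp
  have "(\<lambda>m. x + t m *\<^sub>R w m) \<longlonglongrightarrow> x + 0 *\<^sub>R v"
    by (intro tendsto_intros t0 wv)
  then have in_G: "\<forall>\<^sub>F m in sequentially. x + t m *\<^sub>R w m \<in> G"
    using G by (simp add: topological_tendstoD)
  have g_ev: "\<forall>\<^sub>F m in sequentially. g i (x + t m *\<^sub>R w m) \<ge> 0" if i: "i \<in> {1..k}" for i
  proof (cases "g i x = 0")
    case True
    have "\<forall>\<^sub>F m in sequentially. (g i (x + t m *\<^sub>R w m) - g i x) / t m > 0"
      by (rule order_tendstoD(1)[OF quot[OF Dg[OF i]] gv[OF i True]])
    then show ?thesis
      by eventually_elim (use t(1) True in \<open>simp add: zero_less_divide_iff less_imp_le not_less_iff_gr_or_eq order_less_not_sym\<close>)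
  next
    case False
    \<comment> \<open>Convergence of \<open>g i\<close> along these points is read off from the
      quotient: the increment is a convergent quotient times a step tending to 0.\<close>
    have "(\<lambda>m. g i x + (g i (x + t m *\<^sub>R w m) - g i x) / t m * t m) \<longlonglongrightarrow> g i x + blinfun_apply (Dg i) v * 0"
      by (intro tendsto_intros t0 quot Dg i)
    moreover have "g i x + (g i (x + t m *\<^sub>R w m) - g i x) / t m * t m = g i (x + t m *\<^sub>R w m)" for m
      using t(1)[of m] by simp
    ultimately have "(\<lambda>m. g i (x + t m *\<^sub>R w m)) \<longlonglongrightarrow> g i x" by simp
    then have "\<forall>\<^sub>F m in sequentially. g i (x + t m *\<^sub>R w m) > 0"
      using False g_nonneg[OF i] by (intro order_tendstoD) auto
    then show ?thesis by eventually_elim simp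
  qed
  have h_all: "h j (x + t m *\<^sub>R w m) = 0" if "j \<in> {1..l}" for j m
    using tc[of m] that by (cases j) (auto simp: w_def)
  have "\<forall>\<^sub>F m in sequentially. \<forall>i\<in>{1..k}. g i (x + t m *\<^sub>R w m) \<ge> 0"
    by (intro eventually_ball_finite ballI g_ev) auto
  with in_G have "\<forall>\<^sub>F m in sequentially. (f (x + t m *\<^sub>R w m) - f x) / t m \<le> 0"
  proof eventually_elim
    case (elim m)
    then have "f (x + t m *\<^sub>R w m) \<le> f x" by (intro max h_all) auto
    then show ?case using t(1)[of m] by (simp add: divide_le_0_iff)
  qed
  then show ?thesis
    by (intro tendsto_upperbound[OF quot[OF Df]]) auto
qed

text \<open>The vectors \<open>e\<close> dual to all the gradients serve as test directions.
  \<open>Df\<close> vanishes on the common kernel of the gradients, where both a vector and its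
  negative are feasible directions, so \<open>Df\<close> is a combination of the gradients with
  coefficients read off on the \<open>e i\<close>.\<close>

lemma multipliers_exist:
  fixes f :: "'a::real_normed_vector \<Rightarrow> real" and g h :: "nat \<Rightarrow> 'a \<Rightarrow> real"
  assumes G: "open G" "x \<in> G"
    and g_nonneg: "\<And>i. i \<in> {1..k} \<Longrightarrow> g i x \<ge> 0"
    and h_zero: "\<And>j. j \<in> {1..l} \<Longrightarrow> h j x = 0"
    and max: "\<And>z. z \<in> G \<Longrightarrow> (\<And>i. i \<in> {1..k} \<Longrightarrow> g i z \<ge> 0) \<Longrightarrow>
      (\<And>j. j \<in> {1..l} \<Longrightarrow> h j z = 0) \<Longrightarrow> f z \<le> f x"
    and Df: "has_hadamard_differential f x Df"
    and Dg: "\<And>i. i \<in> {1..k} \<Longrightarrow> has_hadamard_differential (g i) x (Dg i)"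
    and Dh: "\<And>j. j \<in> {1..l} \<Longrightarrow> has_hadamard_differential (h j) x (Dh j)"
    and cont: "\<And>j. j \<in> {1..l} \<Longrightarrow> \<exists>N. open N \<and> x \<in> N \<and> continuous_on N (h j)"
    and indep: "lin_indep_family ({1..k} <+> {1..l}) (case_sum Dg Dh)"
  shows "\<exists>lam mu. (\<forall>i\<in>{1..k}. lam i \<ge> 0 \<and> lam i * g i x = 0) \<and>
    Df + (\<Sum>i=1..k. lam i *\<^sub>R Dg i) + (\<Sum>j=1..l. mu j *\<^sub>R Dh j) = 0"
proof -
  let ?I = "{1..k} <+> {1..l}" and ?U = "case_sum Dg Dh"
  obtain e where e: "\<And>i j. i \<in> ?I \<Longrightarrow> j \<in> ?I \<Longrightarrow> blinfun_apply (?U i) (e j) = (if i = j then 1 else 0)"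
    using lin_indep_family_dual_basis[OF _ indep] by auto
  have eg: "blinfun_apply (Dg m) (e (Inl i)) = (if m = i then 1 else 0)" if "m \<in> {1..k}" "i \<in> {1..k}" for m i
    using e[OF InlI[OF that(1)] InlI[OF that(2)]] by simp
  have eh: "blinfun_apply (Dh m) (e (Inl i)) = 0" if "m \<in> {1..l}" "i \<in> {1..k}" for m i
    using e[OF InrI[OF that(1)] InlI[OF that(2)]] by simp
  \<comment> \<open>This direction has slope 1 for every inequality constraint and is tangent to the
    equality constraints. Adding \<open>t *\<^sub>R s\<close> makes weak slopes strict, and
    \<open>t\<close> then tends to 0 in \<open>nonpos\<close>.\<close>
  define s where "s = (\<Sum>i=1..k. e (Inl i))"
  have gs: "blinfun_apply (Dg i) s = 1" if "i \<in> {1..k}" for i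
    using that by (simp add: s_def blinfun.sum_right eg)
  have hs: "blinfun_apply (Dh j) s = 0" if "j \<in> {1..l}" for j
    using that by (simp add: s_def blinfun.sum_right eh)
  have nonpos: "blinfun_apply Df v \<le> 0"
    if gv: "\<And>i. i \<in> {1..k} \<Longrightarrow> g i x = 0 \<Longrightarrow> blinfun_apply (Dg i) v \<ge> 0"
      and hv: "\<And>j. j \<in> {1..l} \<Longrightarrow> blinfun_apply (Dh j) v = 0" for v
  proof -
    have "blinfun_apply Df (v + t *\<^sub>R s) \<le> 0" if "t > 0" for t
    proof (rule first_order_necessary_condition[OF G g_nonneg h_zero max Df Dg Dh cont])
      show "blinfun_apply (Dh i) (e (Inr j)) = (if i = j then 1 else 0)"
        if "i \<in> {1..l}" "j \<in> {1..l}" for i j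
        using e[OF InrI[OF that(1)] InrI[OF that(2)]] by simp
      show "blinfun_apply (Dg i) (v + t *\<^sub>R s) > 0" if "i \<in> {1..k}" "g i x = 0" for i
        using gv[OF that] gs[OF that(1)] \<open>t > 0\<close> by (simp add: blinfun.add_right blinfun.scaleR_right)
      show "blinfun_apply (Dh j) (v + t *\<^sub>R s) = 0" if "j \<in> {1..l}" for j
        using hv[OF that] hs[OF that] by (simp add: blinfun.add_right blinfun.scaleR_right)
    qed
    then have "\<forall>\<^sub>F t in at_right 0. blinfun_apply Df (v + t *\<^sub>R s) \<le> 0"
      by (intro eventually_mono[OF eventually_at_right_less[of 0]]) simp
    moreover have "((\<lambda>t. blinfun_apply Df (v + t *\<^sub>R s)) \<longlongrightarrow> blinfun_apply Df (v + 0 *\<^sub>R s)) (at_right 0)"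
      by (intro tendsto_intros)
    ultimately show ?thesis
      by (auto dest: tendsto_upperbound)
  qed
  define c where "c i = - blinfun_apply Df (e i)" for i
  have zero: "Df + (\<Sum>i\<in>?I. c i *\<^sub>R ?U i) = 0"
  proof (rule blinfun_eqI)
    fix v
    \<comment> \<open>\<open>z\<close> is the projection of \<open>v\<close> onto the common kernel
      along the \<open>e i\<close>; the identity at \<open>v\<close> amounts to
      \<open>Df z = 0\<close>.\<close>
    define z where "z = v - (\<Sum>i\<in>?I. blinfun_apply (?U i) v *\<^sub>R e i)"
    have Uz: "blinfun_apply (?U m) z = 0" if "m \<in> ?I" for m
    proof -
      have "(\<Sum>i\<in>?I. blinfun_apply (?U i) v * blinfun_apply (?U m) (e i))
          = (\<Sum>i\<in>?I. if m = i then blinfun_apply (?U i) v else 0)"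
        using that by (intro sum.cong) (simp_all add: e)
      also have "\<dots> = blinfun_apply (?U m) v"
        using that by (simp only: sum.delta' finite_Plus finite_atLeastAtMost if_True)
      finally show ?thesis
        by (simp only: z_def blinfun.diff_right blinfun.sum_right blinfun.scaleR_right
            real_scaleR_def diff_self)
    qed
    have Dgz: "blinfun_apply (Dg i) z = 0" if "i \<in> {1..k}" for i
      using Uz[OF InlI[OF that]] by simp
    have Dhz: "blinfun_apply (Dh j) z = 0" if "j \<in> {1..l}" for j
      using Uz[OF InrI[OF that]] by simp
    have "blinfun_apply Df z \<le> 0" "blinfun_apply Df (- z) \<le> 0"
      by (rule nonpos; simp add: Dgz Dhz blinfun.minus_right)+
    then have "blinfun_apply Df z = 0"
      by (simp add: blinfun.minus_right)
    then show "blinfun_apply (Df + (\<Sum>i\<in>?I. c i *\<^sub>R ?U i)) v = blinfun_apply 0 v"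
      by (simp only: z_def c_def blinfun.diff_right blinfun.sum_right blinfun.scaleR_right
          blinfun.add_left blinfun.sum_left blinfun.scaleR_left real_scaleR_def sum_negf
          mult_minus_left blinfun.zero_left mult.commute)
  qed
  have "c (Inl i) \<ge> 0" if "i \<in> {1..k}" for i
    using nonpos[of "e (Inl i)"] that by (simp add: eg eh c_def)
  moreover have "c (Inl i) * g i x = 0" if i: "i \<in> {1..k}" for i
  proof (cases "g i x = 0")
    case False
    \<comment> \<open>Moving along \<open>- e (Inl i)\<close> changes to first order only the
      inactive constraint \<open>i\<close>, so this direction is feasible too and the multiplier is
      also nonpositive.\<close>
    have "blinfun_apply Df (- e (Inl i)) \<le> 0"
    proof (rule nonpos)
      fix m assume "m \<in> {1..k}" "g m x = 0"
      moreover from this False have "m \<noteq> i" by blast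
      ultimately show "blinfun_apply (Dg m) (- e (Inl i)) \<ge> 0"
        using i by (simp add: blinfun.minus_right eg)
    qed (use i in \<open>simp add: blinfun.minus_right eh\<close>)
    with calculation[OF i] show ?thesis by (simp add: c_def blinfun.minus_right)
  qed simp
  moreover have "Df + (\<Sum>i=1..k. c (Inl i) *\<^sub>R Dg i) + (\<Sum>j=1..l. c (Inr j) *\<^sub>R Dh j) = 0"
    using zero by (simp add: sum.Plus add.assoc)
  ultimately show ?thesis
    by (intro exI[of _ "\<lambda>i. c (Inl i)"] exI[of _ "\<lambda>j. c (Inr j)"]) auto
qed

section \<open>The envelope formula\<close>

lemma has_hadamard_differential_partial1:
  assumes "has_hadamard_differential \<psi> (x, \<pi>) D"
  shows "has_hadamard_differential (\<lambda>z. \<psi> (z, \<pi>)) x (Blinfun (\<lambda>v. blinfun_apply D (v, 0)))"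
proof -
  have "bounded_linear (\<lambda>v. blinfun_apply D (v, 0))"
    by (intro bounded_linear_intros)
  then show ?thesis
    unfolding has_hadamard_differential_def has_hadamard_variation_def
  proof (intro allI impI, goal_cases)
    case (1 v \<theta> w)
    have "(\<lambda>n. (w n, 0)) \<longlonglongrightarrow> (v, 0)"
      using 1 by (intro tendsto_intros)
    from has_hadamard_differential_seqD[OF assms _ _ this, of \<theta>] 1 show ?case
      by (simp add: bounded_linear_Blinfun_apply)
  qed
qed

lemma has_hadamard_differential_partial2:
  assumes "has_hadamard_differential \<psi> (x, \<pi>) D"
  shows "has_hadamard_differential (\<lambda>\<rho>. \<psi> (x, \<rho>)) \<pi> (Blinfun (\<lambda>v. blinfun_apply D (0, v)))"
proof -
  have "bounded_linear (\<lambda>v. blinfun_apply D (0, v))"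
    by (intro bounded_linear_intros)
  then show ?thesis
    unfolding has_hadamard_differential_def has_hadamard_variation_def
  proof (intro allI impI, goal_cases)
    case (1 v \<theta> w)
    have "(\<lambda>n. (0, w n)) \<longlonglongrightarrow> (0, v)"
      using 1 by (intro tendsto_intros)
    from has_hadamard_differential_seqD[OF assms _ _ this, of \<theta>] 1 show ?case
      by (simp add: bounded_linear_Blinfun_apply)
  qed
qed

text \<open>The joint differential restricted to the two axes gives the partial differentials, so
  the descriptions behind \<open>D_H1\<close> and \<open>D_H2\<close> denote these restrictions;
  linearity then splits \<open>(v, w)\<close>.\<close>

lemma D_H_prod_apply:
  fixes \<psi> :: "'a::real_normed_vector \<times> 'b::real_normed_vector \<Rightarrow> real"
  assumes "hadamard_differentiable \<psi> (x, \<pi>)"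
  shows "blinfun_apply (D_H \<psi> (x, \<pi>)) (v, w) =
    blinfun_apply (D_H1 \<psi> x \<pi>) v + blinfun_apply (D_H2 \<psi> x \<pi>) w"
proof -
  note D = D_H_works[OF assms]
  let ?D = "D_H \<psi> (x, \<pi>)"
  have "bounded_linear (\<lambda>v. blinfun_apply ?D (v, 0))" "bounded_linear (\<lambda>v. blinfun_apply ?D (0, v))"
    by (intro bounded_linear_intros)+
  then have "blinfun_apply (D_H1 \<psi> x \<pi>) v = blinfun_apply ?D (v, 0)"
    "blinfun_apply (D_H2 \<psi> x \<pi>) w = blinfun_apply ?D (0, w)"
    unfolding D_H1_def D_H2_def
    using D_H_eqI[OF has_hadamard_differential_partial1[OF D]]
      D_H_eqI[OF has_hadamard_differential_partial2[OF D]]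
    by (simp_all add: bounded_linear_Blinfun_apply)
  then show ?thesis
    by (simp flip: blinfun.add_right)
qed

text \<open>A chain rule. The quotients of \<open>xs\<close> give directions that vary with the step
  and merely converge, which is what Hadamard differentiability of \<open>\<psi>\<close>
  accommodates.\<close>

lemma has_right_dir_deriv_along_graph:
  fixes \<psi> :: "'a::real_normed_vector \<times> 'b::real_normed_vector \<Rightarrow> real"
  assumes \<psi>: "hadamard_differentiable \<psi> (xs \<pi>, \<pi>)" and xs: "has_right_dir_deriv xs \<pi> \<omega> d"
  shows "has_right_dir_deriv (\<lambda>\<rho>. \<psi> (xs \<rho>, \<rho>)) \<pi> \<omega>
    (blinfun_apply (D_H1 \<psi> (xs \<pi>) \<pi>) d + blinfun_apply (D_H2 \<psi> (xs \<pi>) \<pi>) \<omega>)"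
proof -
  \<comment> \<open>For \<open>t > 0\<close>, moving by \<open>t\<close> along \<open>w t\<close>
    lands exactly on the graph point over the parameter
    \<open>\<pi> + t *\<^sub>R \<omega>\<close>.\<close>
  define w where "w t = ((1 / t) *\<^sub>R (xs (\<pi> + t *\<^sub>R \<omega>) - xs \<pi>), \<omega>)" for t :: real
  have "(w \<longlongrightarrow> (d, \<omega>)) (at_right 0)"
    using xs unfolding w_def has_right_dir_deriv_def by (intro tendsto_intros)
  from has_hadamard_differential_at_rightD[OF D_H_works[OF \<psi>] this]
  have "((\<lambda>t. (1 / t) *\<^sub>R (\<psi> ((xs \<pi>, \<pi>) + t *\<^sub>R w t) - \<psi> (xs \<pi>, \<pi>))) \<longlongrightarrow>
    blinfun_apply (D_H1 \<psi> (xs \<pi>) \<pi>) d + blinfun_apply (D_H2 \<psi> (xs \<pi>) \<pi>) \<omega>) (at_right 0)"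
    by (simp only: D_H_prod_apply[OF \<psi>])
  moreover have "\<forall>\<^sub>F t in at_right 0. (xs \<pi>, \<pi>) + t *\<^sub>R w t = (xs (\<pi> + t *\<^sub>R \<omega>), \<pi> + t *\<^sub>R \<omega>)"
    by (intro eventually_mono[OF eventually_at_right_less[of "0::real"]]) (simp add: w_def)
  ultimately show ?thesis
    unfolding has_right_dir_deriv_def
    by (elim Lim_transform_eventually) (auto elim!: eventually_mono)
qed

section \<open>Right directional derivatives along rays of parameters\<close>

lemma has_right_dir_deriv_unique:
  assumes "has_right_dir_deriv \<phi> x v d" "has_right_dir_deriv \<phi> x v d'"
  shows "d = d'"
  using assms unfolding has_right_dir_deriv_def by (intro tendsto_unique) auto

lemma filterlim_ray: "((\<lambda>t. p + t *\<^sub>R \<omega>) \<longlongrightarrow> (p::'b::real_normed_vector)) (at_right (0::real))"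
proof -
  have "((\<lambda>t. p + t *\<^sub>R \<omega>) \<longlongrightarrow> p + 0 *\<^sub>R \<omega>) (at_right (0::real))"
    by (intro tendsto_intros)
  then show ?thesis by simp
qed

lemma has_right_dir_deriv_cong_open:
  fixes p :: "'b::real_normed_vector"
  assumes "has_right_dir_deriv \<phi> p \<omega> d" "open P" "p \<in> P" "\<And>\<rho>. \<rho> \<in> P \<Longrightarrow> \<phi> \<rho> = \<phi>' \<rho>"
  shows "has_right_dir_deriv \<phi>' p \<omega> d"
  unfolding has_right_dir_deriv_def
proof (rule Lim_transform_eventually[OF assms(1)[unfolded has_right_dir_deriv_def]])
  have "\<forall>\<^sub>F t in at_right 0. p + t *\<^sub>R \<omega> \<in> P"
    by (rule topological_tendstoD[OF filterlim_ray assms(2,3)])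
  then show "\<forall>\<^sub>F t in at_right 0. (1 / t) *\<^sub>R (\<phi> (p + t *\<^sub>R \<omega>) - \<phi> p) = (1 / t) *\<^sub>R (\<phi>' (p + t *\<^sub>R \<omega>) - \<phi>' p)"
    by eventually_elim (simp add: assms)
qed

section \<open>Multipliers of the parametrized problem\<close>

abbreviation (input) constraint_gradients_indep where
  "constraint_gradients_indep k g l h x \<pi> \<equiv> lin_indep_family ({1..k} <+> {1..l})
     (case_sum (\<lambda>i. D_H1 (g i) x \<pi>) (\<lambda>j. D_H1 (h j) x \<pi>))"

text \<open>Stationarity over the disjoint sum of the index sets, the form in which the results on a
  single independent family apply.\<close>

lemma KKT_multipliers_sum_Plus:
  assumes "KKT_multipliers f k g l h x \<pi> lam mu"
  shows "D_H1 f x \<pi> + (\<Sum>s\<in>{1..k} <+> {1..l}. case_sum lam mu s *\<^sub>R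
    case_sum (\<lambda>i. D_H1 (g i) x \<pi>) (\<lambda>j. D_H1 (h j) x \<pi>) s) = 0"
  using assms by (simp add: KKT_multipliers_def sum.Plus add.assoc)

text \<open>The filter is left general: a ray gives persistence of positive multipliers, and
  neighborhoods of a parameter give continuity of the derivative.\<close>

lemma KKT_multipliers_tendsto:
  assumes conv: "\<And>\<psi>. \<psi> \<in> {f} \<union> g ` {1..k} \<union> h ` {1..l} \<Longrightarrow>
      ((\<lambda>t. D_H1 \<psi> (y t) (r t)) \<longlongrightarrow> D_H1 \<psi> x \<pi>) F"
    and indep: "constraint_gradients_indep k g l h x \<pi>"
    and K0: "KKT_multipliers f k g l h x \<pi> lam mu"
    and K: "\<forall>\<^sub>F t in F. KKT_multipliers f k g l h (y t) (r t) (L t) (M t)"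
  shows "\<And>i. i \<in> {1..k} \<Longrightarrow> ((\<lambda>t. L t i) \<longlongrightarrow> lam i) F"
    and "\<And>j. j \<in> {1..l} \<Longrightarrow> ((\<lambda>t. M t j) \<longlongrightarrow> mu j) F"
proof -
  have *: "((\<lambda>t. case_sum (L t) (M t) s) \<longlongrightarrow> case_sum lam mu s) F"
    if "s \<in> {1..k} <+> {1..l}" for s
  proof (rule tendsto_multipliers[OF _ _ conv indep KKT_multipliers_sum_Plus[OF K0] _ that])
    show "((\<lambda>t. case_sum (\<lambda>i. D_H1 (g i) (y t) (r t)) (\<lambda>j. D_H1 (h j) (y t) (r t)) i) \<longlongrightarrow>
        case_sum (\<lambda>i. D_H1 (g i) x \<pi>) (\<lambda>j. D_H1 (h j) x \<pi>) i) F" if "i \<in> {1..k} <+> {1..l}" for i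
      using that by (auto simp del: atLeastAtMost_iff intro!: conv)
    show "\<forall>\<^sub>F t in F. D_H1 f (y t) (r t) + (\<Sum>i\<in>{1..k} <+> {1..l}. case_sum (L t) (M t) i *\<^sub>R
        case_sum (\<lambda>i. D_H1 (g i) (y t) (r t)) (\<lambda>j. D_H1 (h j) (y t) (r t)) i) = 0"
      using K by eventually_elim (rule KKT_multipliers_sum_Plus)
  qed auto
  show "((\<lambda>t. L t i) \<longlongrightarrow> lam i) F" if "i \<in> {1..k}" for i
    using *[OF InlI[OF that]] by simp
  show "((\<lambda>t. M t j) \<longlongrightarrow> mu j) F" if "j \<in> {1..l}" for j
    using *[OF InrI[OF that]] by simp
qed

text \<open>Subtracting two stationarity equations leaves a vanishing combination of the independent
  gradients.\<close>

lemma KKT_multipliers_imp_unique: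
  assumes K: "KKT_multipliers f k g l h x \<pi> lam mu"
    and indep: "constraint_gradients_indep k g l h x \<pi>"
  shows "unique_KKT_multipliers f k g l h x \<pi> lam mu"
  unfolding unique_KKT_multipliers_def
proof (intro conjI allI impI K)
  fix lam' mu' assume K': "KKT_multipliers f k g l h x \<pi> lam' mu'"
  let ?U = "case_sum (\<lambda>i. D_H1 (g i) x \<pi>) (\<lambda>j. D_H1 (h j) x \<pi>)"
  have "(\<Sum>s\<in>{1..k} <+> {1..l}. (case_sum lam' mu' s - case_sum lam mu s) *\<^sub>R ?U s) = 0"
    unfolding scaleR_diff_left sum_subtractf right_minus_eq
    by (rule add_left_imp_eq[OF trans[OF KKT_multipliers_sum_Plus[OF K'] KKT_multipliers_sum_Plus[OF K, symmetric]]])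
  then have *: "\<forall>s\<in>{1..k} <+> {1..l}. case_sum lam' mu' s - case_sum lam mu s = 0"
    using indep[unfolded lin_indep_family_def, rule_format,
        of "\<lambda>s. case_sum lam' mu' s - case_sum lam mu s"] by blast
  show "\<forall>i\<in>{1..k}. lam' i = lam i"
    using *[rule_format, OF InlI] by simp
  show "\<forall>j\<in>{1..l}. mu' j = mu j"
    using *[rule_format, OF InrI] by simp
qed

lemma KKT_multipliers_exist:
  fixes G :: "'a::real_normed_vector set" and f :: "'a \<times> 'b::real_normed_vector \<Rightarrow> real"
  assumes "open G" and sol: "is_solution G f k g l h \<pi> x"
    and diff: "\<And>\<psi>. \<psi> \<in> {f} \<union> g ` {1..k} \<union> h ` {1..l} \<Longrightarrow> hadamard_differentiable (\<lambda>z. \<psi> (z, \<pi>)) x"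
    and cont: "\<And>j. j \<in> {1..l} \<Longrightarrow> \<exists>N. open N \<and> x \<in> N \<and> continuous_on N (\<lambda>z. h j (z, \<pi>))"
    and indep: "constraint_gradients_indep k g l h x \<pi>"
  shows "\<exists>lam mu. KKT_multipliers f k g l h x \<pi> lam mu"
  unfolding KKT_multipliers_def
proof (rule multipliers_exist)
  show "has_hadamard_differential (\<lambda>z. f (z, \<pi>)) x (D_H1 f x \<pi>)"
    unfolding D_H1_def by (intro D_H_works diff) simp
  show "has_hadamard_differential (\<lambda>z. g i (z, \<pi>)) x (D_H1 (g i) x \<pi>)" if "i \<in> {1..k}" for i
    unfolding D_H1_def using that by (intro D_H_works diff) simp
  show "has_hadamard_differential (\<lambda>z. h j (z, \<pi>)) x (D_H1 (h j) x \<pi>)" if "j \<in> {1..l}" for j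
    unfolding D_H1_def using that by (intro D_H_works diff) simp
qed (use assms in \<open>auto simp: is_solution_def admissible_def\<close>)

lemma problem_value_eq:
  assumes "is_solution G f k g l h \<pi> x"
  shows "problem_value G f k g l h \<pi> = f (x, \<pi>)"
  using assms unfolding is_solution_def problem_value_def by (intro cSup_eq_maximum) auto

text \<open>The base parameter \<open>p\<close> is arbitrary, so that the formula serves both at
  \<open>\<pi>\<^sub>0\<close> and throughout a neighborhood. Stationarity trades the derivative of
  \<open>f\<close> in the unknown direction \<open>d\<close> for those of the constraints, whose
  total derivatives along the ray vanish once weighted by the multipliers.\<close>

lemma envelope_directional:
  fixes G :: "'a::real_normed_vector set" and f :: "'a \<times> 'b::real_normed_vector \<Rightarrow> real"
  assumes G: "open G"
    and P: "open P" "p \<in> P"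
    and sol: "\<And>\<pi>. \<pi> \<in> P \<Longrightarrow> is_solution G f k g l h \<pi> (xs \<pi>)"
    and joint: "\<And>\<psi>. \<psi> \<in> {f} \<union> g ` {1..k} \<union> h ` {1..l} \<Longrightarrow> hadamard_differentiable \<psi> (xs p, p)"
    and D1cont: "\<And>\<psi>. \<psi> \<in> {f} \<union> g ` {1..k} \<union> h ` {1..l} \<Longrightarrow>
      continuous_on P (\<lambda>\<pi>. D_H1 \<psi> (xs \<pi>) \<pi>)"
    and indep: "constraint_gradients_indep k g l h (xs p) p"
    and KKT_ex: "\<And>\<pi>. \<pi> \<in> P \<Longrightarrow> constraint_gradients_indep k g l h (xs \<pi>) \<pi> \<Longrightarrow>
      \<exists>lam mu. KKT_multipliers f k g l h (xs \<pi>) \<pi> lam mu"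
    and K: "KKT_multipliers f k g l h (xs p) p lam mu"
    and xs: "has_right_dir_deriv xs p \<omega> d"
  shows "has_right_dir_deriv (problem_value G f k g l h) p \<omega>
    (blinfun_apply (D_H2 f (xs p) p) \<omega>
     + (\<Sum>i=1..k. lam i * blinfun_apply (D_H2 (g i) (xs p) p) \<omega>)
     + (\<Sum>j=1..l. mu j * blinfun_apply (D_H2 (h j) (xs p) p) \<omega>))"
proof -
  let ?\<Psi> = "{f} \<union> g ` {1..k} \<union> h ` {1..l}"
  let ?D1 = "\<lambda>\<psi>. blinfun_apply (D_H1 \<psi> (xs p) p) d"
  let ?D2 = "\<lambda>\<psi>. blinfun_apply (D_H2 \<psi> (xs p) p) \<omega>"
  let ?r = "\<lambda>t::real. p + t *\<^sub>R \<omega>"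
  have chain: "has_right_dir_deriv (\<lambda>\<rho>. \<psi> (xs \<rho>, \<rho>)) p \<omega> (?D1 \<psi> + ?D2 \<psi>)" if "\<psi> \<in> ?\<Psi>" for \<psi>
    using joint[OF that] xs by (rule has_right_dir_deriv_along_graph)
  have zero: "has_right_dir_deriv (\<lambda>\<rho>. 0::real) p \<omega> 0"
    by (simp add: has_right_dir_deriv_def)
  have ray_P: "\<forall>\<^sub>F t in at_right 0. ?r t \<in> P"
    by (rule topological_tendstoD[OF filterlim_ray P])
  have conv: "((\<lambda>t. D_H1 \<psi> (xs (?r t)) (?r t)) \<longlongrightarrow> D_H1 \<psi> (xs p) p) (at_right 0)" if "\<psi> \<in> ?\<Psi>" for \<psi>
    by (rule continuous_on_tendsto_compose[OF D1cont[OF that] filterlim_ray P(2) ray_P])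
  have "\<forall>\<^sub>F t in at_right 0. constraint_gradients_indep k g l h (xs (?r t)) (?r t)"
    using indep
    by (intro eventually_lin_indep_family[where U = "\<lambda>t. case_sum (\<lambda>i. D_H1 (g i) (xs (?r t)) (?r t))
          (\<lambda>j. D_H1 (h j) (xs (?r t)) (?r t))"])
       (auto simp del: atLeastAtMost_iff intro!: conv)
  \<comment> \<open>Independence persists along the ray, so multipliers exist at its nearby points;
    they are then selected as functions \<open>L\<close>, \<open>M\<close> of
    \<open>t\<close>.\<close>
  with ray_P have "\<forall>\<^sub>F t in at_right 0. \<exists>lam mu. KKT_multipliers f k g l h (xs (?r t)) (?r t) lam mu"
    by eventually_elim (rule KKT_ex)
  then obtain L M where LM: "\<forall>\<^sub>F t in at_right 0. KKT_multipliers f k g l h (xs (?r t)) (?r t) (L t) (M t)"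
    unfolding eventually_ex by blast
  have f: "has_right_dir_deriv (problem_value G f k g l h) p \<omega> (?D1 f + ?D2 f)"
    using chain[of f] P by (rule has_right_dir_deriv_cong_open) (simp_all add: problem_value_eq[OF sol])
  \<comment> \<open>The constraint is identically 0 along the solutions, so by uniqueness the chain
    rule derivative must be 0.\<close>
  have h: "?D1 (h j) + ?D2 (h j) = 0" if j: "j \<in> {1..l}" for j
  proof (rule has_right_dir_deriv_unique)
    show "has_right_dir_deriv (\<lambda>\<rho>. h j (xs \<rho>, \<rho>)) p \<omega> (?D1 (h j) + ?D2 (h j))"
      using j by (intro chain) auto
    show "has_right_dir_deriv (\<lambda>\<rho>. h j (xs \<rho>, \<rho>)) p \<omega> 0"
      using zero P by (rule has_right_dir_deriv_cong_open) (use sol j in \<open>auto simp: is_solution_def admissible_def\<close>)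
  qed
  \<comment> \<open>A positive multiplier stays positive along the ray, so its constraint stays active.\<close>
  have g: "lam i * (?D1 (g i) + ?D2 (g i)) = 0" if i: "i \<in> {1..k}" for i
  proof (cases "lam i = 0")
    case False
    then have pos: "lam i > 0" and act: "g i (xs p, p) = 0"
      using K i by (auto simp: KKT_multipliers_def less_le)
    have "((\<lambda>t. L t i) \<longlongrightarrow> lam i) (at_right 0)"
      by (rule KKT_multipliers_tendsto(1)[OF conv indep K LM i])
    then have "\<forall>\<^sub>F t in at_right 0. L t i > 0"
      using pos by (rule order_tendstoD)
    with LM have "\<forall>\<^sub>F t in at_right 0. 0 = (1 / t) *\<^sub>R (g i (xs (?r t), ?r t) - g i (xs p, p))"
      by eventually_elim (use i act in \<open>force simp: KKT_multipliers_def\<close>)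
    then have "has_right_dir_deriv (\<lambda>\<rho>. g i (xs \<rho>, \<rho>)) p \<omega> 0"
      unfolding has_right_dir_deriv_def by (rule Lim_transform_eventually[OF tendsto_const])
    moreover have "has_right_dir_deriv (\<lambda>\<rho>. g i (xs \<rho>, \<rho>)) p \<omega> (?D1 (g i) + ?D2 (g i))"
      using i by (intro chain) auto
    ultimately have "?D1 (g i) + ?D2 (g i) = 0"
      by (blast dest: has_right_dir_deriv_unique)
    then show ?thesis by simp
  qed simp
  have "blinfun_apply (D_H1 f (xs p) p + (\<Sum>i=1..k. lam i *\<^sub>R D_H1 (g i) (xs p) p)
      + (\<Sum>j=1..l. mu j *\<^sub>R D_H1 (h j) (xs p) p)) d = 0"
    using K by (simp add: KKT_multipliers_def)
  then have "?D1 f + (\<Sum>i=1..k. lam i * ?D1 (g i)) + (\<Sum>j=1..l. mu j * ?D1 (h j)) = 0"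
    by (simp add: blinfun.add_left blinfun.sum_left blinfun.scaleR_left)
  moreover have "(\<Sum>i=1..k. lam i * ?D1 (g i)) = - (\<Sum>i=1..k. lam i * ?D2 (g i))"
    unfolding sum_negf[symmetric] using g by (intro sum.cong refl) (simp add: distrib_left eq_neg_iff_add_eq_0)
  moreover have "(\<Sum>j=1..l. mu j * ?D1 (h j)) = - (\<Sum>j=1..l. mu j * ?D2 (h j))"
    unfolding sum_negf[symmetric] using h
    by (intro sum.cong refl) (simp add: eq_neg_iff_add_eq_0 flip: distrib_left)
  ultimately have "?D1 f + ?D2 f
      = ?D2 f + (\<Sum>i=1..k. lam i * ?D2 (g i)) + (\<Sum>j=1..l. mu j * ?D2 (h j))"
    by linarith
  with f show ?thesis by simp
qed

text \<open>Uniqueness of the multipliers is asserted together with their existence, so that the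
  multipliers in each formula are determined at all relevant indices.\<close>

theorem theorem3p1:
  fixes G :: "'a::real_normed_vector set"
    and f :: "'a \<times> 'b::real_normed_vector \<Rightarrow> real"
    and k l :: nat
    and g h :: "nat \<Rightarrow> 'a \<times> 'b \<Rightarrow> real"
    and \<pi>\<^sub>0 :: 'b
    and P :: "'b set"
    and xs :: "'b \<Rightarrow> 'a"
  assumes G: "open G"
    and Dua: "\<exists>B :: ('a \<Rightarrow>\<^sub>L real) \<Rightarrow> ('a \<Rightarrow>\<^sub>L real) \<Rightarrow> real.
                is_inner_product B \<and> continuous_on UNIV (\<lambda>p. B (fst p) (snd p))"
    and Sol1: "open P" "\<pi>\<^sub>0 \<in> P" "\<forall>\<pi>\<in>P. is_solution G f k g l h \<pi> (xs \<pi>)"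
    and Fon1: "\<forall>\<psi> \<in> {f} \<union> g ` {1..k} \<union> h ` {1..l}.
                 hadamard_differentiable \<psi> (xs \<pi>\<^sub>0, \<pi>\<^sub>0) \<and>
                 (\<forall>\<pi>\<in>P. hadamard_differentiable (\<lambda>x. \<psi> (x, \<pi>)) (xs \<pi>)) \<and>
                 continuous_on P (\<lambda>\<pi>. D_H1 \<psi> (xs \<pi>) \<pi>)"
    and Con1: "\<forall>\<pi>\<in>P. \<forall>j\<in>{1..l}. \<exists>N. open N \<and> xs \<pi> \<in> N \<and> N \<subseteq> G \<and>
                 continuous_on N (\<lambda>x. h j (x, \<pi>))"
    and Con2: "lin_indep_family ({1..k} <+> {1..l})
                 (case_sum (\<lambda>i. D_H1 (g i) (xs \<pi>\<^sub>0) \<pi>\<^sub>0) (\<lambda>j. D_H1 (h j) (xs \<pi>\<^sub>0) \<pi>\<^sub>0))"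
  shows
    \<comment> \<open>(i)\<close>
    "(\<forall>\<omega>. (\<exists>d. has_right_dir_deriv xs \<pi>\<^sub>0 \<omega> d) \<longrightarrow>
       (\<exists>lam mu. unique_KKT_multipliers f k g l h (xs \<pi>\<^sub>0) \<pi>\<^sub>0 lam mu \<and>
          has_right_dir_deriv (problem_value G f k g l h) \<pi>\<^sub>0 \<omega>
            (blinfun_apply (D_H2 f (xs \<pi>\<^sub>0) \<pi>\<^sub>0) \<omega>
             + (\<Sum>i=1..k. lam i * blinfun_apply (D_H2 (g i) (xs \<pi>\<^sub>0) \<pi>\<^sub>0) \<omega>)
             + (\<Sum>j=1..l. mu j * blinfun_apply (D_H2 (h j) (xs \<pi>\<^sub>0) \<pi>\<^sub>0) \<omega>))))
     \<and>
     \<comment> \<open>(ii)\<close>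
     ((\<forall>\<omega>. \<exists>d. has_right_dir_deriv xs \<pi>\<^sub>0 \<omega> d) \<longrightarrow>
       (\<exists>lam mu. unique_KKT_multipliers f k g l h (xs \<pi>\<^sub>0) \<pi>\<^sub>0 lam mu \<and>
          has_gateaux_differential (problem_value G f k g l h) \<pi>\<^sub>0
            (D_H2 f (xs \<pi>\<^sub>0) \<pi>\<^sub>0
             + (\<Sum>i=1..k. lam i *\<^sub>R D_H2 (g i) (xs \<pi>\<^sub>0) \<pi>\<^sub>0)
             + (\<Sum>j=1..l. mu j *\<^sub>R D_H2 (h j) (xs \<pi>\<^sub>0) \<pi>\<^sub>0))))
     \<and>
     \<comment> \<open>(iii)\<close>
     ((\<forall>\<pi>\<in>P. \<forall>\<omega>. \<exists>d. has_right_dir_deriv xs \<pi> \<omega> d) \<and>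
      (\<forall>\<psi> \<in> {f} \<union> g ` {1..k} \<union> h ` {1..l}.
         (\<forall>\<pi>\<in>P. hadamard_differentiable \<psi> (xs \<pi>, \<pi>)) \<and>
         continuous_on P (\<lambda>\<pi>. D_H2 \<psi> (xs \<pi>) \<pi>)) \<longrightarrow>
       (\<exists>Q V'. open Q \<and> \<pi>\<^sub>0 \<in> Q \<and> Q \<subseteq> P \<and>
          (\<forall>\<pi>\<in>Q. (problem_value G f k g l h has_derivative blinfun_apply (V' \<pi>)) (at \<pi>)) \<and>
          continuous_on Q V' \<and>
          (\<forall>\<pi>\<in>Q. \<exists>lam mu. unique_KKT_multipliers f k g l h (xs \<pi>) \<pi> lam mu \<and>
             V' \<pi> =
               D_H2 f (xs \<pi>) \<pi>
               + (\<Sum>i=1..k. lam i *\<^sub>R D_H2 (g i) (xs \<pi>) \<pi>)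
               + (\<Sum>j=1..l. mu j *\<^sub>R D_H2 (h j) (xs \<pi>) \<pi>))))"
proof -
  let ?\<Psi> = "{f} \<union> g ` {1..k} \<union> h ` {1..l}"
  let ?V = "problem_value G f k g l h"
  let ?grads = "\<lambda>\<pi>. case_sum (\<lambda>i. D_H1 (g i) (xs \<pi>) \<pi>) (\<lambda>j. D_H1 (h j) (xs \<pi>) \<pi>)"
  let ?indep = "\<lambda>\<pi>. lin_indep_family ({1..k} <+> {1..l}) (?grads \<pi>)"
  let ?KKT = "\<lambda>\<pi>. KKT_multipliers f k g l h (xs \<pi>) \<pi>"
  have sol: "\<And>\<pi>. \<pi> \<in> P \<Longrightarrow> is_solution G f k g l h \<pi> (xs \<pi>)"
    using Sol1(3) by blast
  have D1cont: "continuous_on P (\<lambda>\<pi>. D_H1 \<psi> (xs \<pi>) \<pi>)" if "\<psi> \<in> ?\<Psi>" for \<psi>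
    using Fon1 that by blast
  \<comment> \<open>Independence is given at \<open>\<pi>\<^sub>0\<close> only, so at other
    parameters it stays a premise, discharged later by its persistence.\<close>
  have KKT_ex: "\<exists>lam mu. ?KKT \<pi> lam mu" if "\<pi> \<in> P" "?indep \<pi>" for \<pi>
  proof (rule KKT_multipliers_exist[OF G sol[OF that(1)] _ _ that(2)])
    show "hadamard_differentiable (\<lambda>z. \<psi> (z, \<pi>)) (xs \<pi>)" if "\<psi> \<in> ?\<Psi>" for \<psi>
      using Fon1 that \<open>\<pi> \<in> P\<close> by blast
    show "\<exists>N. open N \<and> xs \<pi> \<in> N \<and> continuous_on N (\<lambda>z. h j (z, \<pi>))" if "j \<in> {1..l}" for j
      using Con1 that \<open>\<pi> \<in> P\<close> by blast
  qed
  have envelope: "has_right_dir_deriv ?V p \<omega>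
    (blinfun_apply (D_H2 f (xs p) p) \<omega>
     + (\<Sum>i=1..k. lam i * blinfun_apply (D_H2 (g i) (xs p) p) \<omega>)
     + (\<Sum>j=1..l. mu j * blinfun_apply (D_H2 (h j) (xs p) p) \<omega>))"
    if "p \<in> P" "\<And>\<psi>. \<psi> \<in> ?\<Psi> \<Longrightarrow> hadamard_differentiable \<psi> (xs p, p)" "?indep p" "?KKT p lam mu"
      "\<exists>d. has_right_dir_deriv xs p \<omega> d" for p lam mu \<omega>
    using that(5) envelope_directional[OF G Sol1(1) that(1) sol that(2) D1cont that(3) KKT_ex that(4)]
    by blast
  have gateaux: "has_gateaux_differential ?V p
    (D_H2 f (xs p) p + (\<Sum>i=1..k. lam i *\<^sub>R D_H2 (g i) (xs p) p)
      + (\<Sum>j=1..l. mu j *\<^sub>R D_H2 (h j) (xs p) p))"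
    if "p \<in> P" "\<And>\<psi>. \<psi> \<in> ?\<Psi> \<Longrightarrow> hadamard_differentiable \<psi> (xs p, p)" "?indep p" "?KKT p lam mu"
      "\<And>\<omega>. \<exists>d. has_right_dir_deriv xs p \<omega> d" for p lam mu
    unfolding has_gateaux_differential_def
    using envelope[OF that(1-4) that(5)]
    by (simp add: blinfun.add_left blinfun.sum_left blinfun.scaleR_left)
  have joint0: "\<And>\<psi>. \<psi> \<in> ?\<Psi> \<Longrightarrow> hadamard_differentiable \<psi> (xs \<pi>\<^sub>0, \<pi>\<^sub>0)"
    using Fon1 by blast
  obtain lam0 mu0 where K0: "?KKT \<pi>\<^sub>0 lam0 mu0"
    using KKT_ex[OF Sol1(2) Con2] by blast
  note unique0 = KKT_multipliers_imp_unique[OF K0 Con2]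
  have C1: "\<exists>Q V'. open Q \<and> \<pi>\<^sub>0 \<in> Q \<and> Q \<subseteq> P \<and>
          (\<forall>\<pi>\<in>Q. (?V has_derivative blinfun_apply (V' \<pi>)) (at \<pi>)) \<and>
          continuous_on Q V' \<and>
          (\<forall>\<pi>\<in>Q. \<exists>lam mu. unique_KKT_multipliers f k g l h (xs \<pi>) \<pi> lam mu \<and>
             V' \<pi> =
               D_H2 f (xs \<pi>) \<pi>
               + (\<Sum>i=1..k. lam i *\<^sub>R D_H2 (g i) (xs \<pi>) \<pi>)
               + (\<Sum>j=1..l. mu j *\<^sub>R D_H2 (h j) (xs \<pi>) \<pi>))"
    if xs: "\<And>\<pi> \<omega>. \<pi> \<in> P \<Longrightarrow> \<exists>d. has_right_dir_deriv xs \<pi> \<omega> d"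
      and joint: "\<And>\<psi> \<pi>. \<psi> \<in> ?\<Psi> \<Longrightarrow> \<pi> \<in> P \<Longrightarrow> hadamard_differentiable \<psi> (xs \<pi>, \<pi>)"
      and D2cont: "\<And>\<psi>. \<psi> \<in> ?\<Psi> \<Longrightarrow> continuous_on P (\<lambda>\<pi>. D_H2 \<psi> (xs \<pi>) \<pi>)"
  proof -
    have "((\<lambda>\<pi>. D_H1 \<psi> (xs \<pi>) \<pi>) \<longlongrightarrow> D_H1 \<psi> (xs \<pi>\<^sub>0) \<pi>\<^sub>0) (nhds \<pi>\<^sub>0)" if "\<psi> \<in> ?\<Psi>" for \<psi>
    proof -
      have "isCont (\<lambda>\<pi>. D_H1 \<psi> (xs \<pi>) \<pi>) \<pi>\<^sub>0"
        using D1cont[OF that] Sol1(1,2) by (simp add: continuous_on_eq_continuous_at)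
      then show ?thesis
        unfolding isCont_def by (rule tendsto_at_iff_tendsto_nhds[THEN iffD1])
    qed
    then have "\<forall>\<^sub>F \<pi> in nhds \<pi>\<^sub>0. ?indep \<pi>"
      by (intro eventually_lin_indep_family[where U = ?grads, OF _ _ Con2])
        (auto simp del: atLeastAtMost_iff)
    moreover have "\<forall>\<^sub>F \<pi> in nhds \<pi>\<^sub>0. \<pi> \<in> P"
      using Sol1(1,2) by (rule eventually_nhds_in_open)
    ultimately have "\<forall>\<^sub>F \<pi> in nhds \<pi>\<^sub>0. \<pi> \<in> P \<and> ?indep \<pi>"
      by eventually_elim simp
    \<comment> \<open>\<open>Q\<close> is a neighborhood on which the gradients stay independent;
      the multipliers exist and are unique there.\<close>
    then obtain Q where Q: "open Q" "\<pi>\<^sub>0 \<in> Q" "Q \<subseteq> P" and indep: "\<And>\<pi>. \<pi> \<in> Q \<Longrightarrow> ?indep \<pi>"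
      unfolding eventually_nhds by blast
    \<comment> \<open>Membership in \<open>Q\<close> is placed under the quantifiers so that the
      choice yields total functions \<open>L\<close>, \<open>M\<close>.\<close>
    have "\<forall>\<pi>. \<exists>lam mu. \<pi> \<in> Q \<longrightarrow> ?KKT \<pi> lam mu"
      using KKT_ex indep Q(3) by blast
    then obtain L M where LM: "\<And>\<pi>. \<pi> \<in> Q \<Longrightarrow> ?KKT \<pi> (L \<pi>) (M \<pi>)"
      by metis
    define V' where "V' \<pi> = D_H2 f (xs \<pi>) \<pi> + (\<Sum>i=1..k. L \<pi> i *\<^sub>R D_H2 (g i) (xs \<pi>) \<pi>)
      + (\<Sum>j=1..l. M \<pi> j *\<^sub>R D_H2 (h j) (xs \<pi>) \<pi>)" for \<pi>
    have V'_cont: "continuous_on Q V'"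
      unfolding continuous_on_def
    proof
      fix p assume p: "p \<in> Q"
      have conv1: "((\<lambda>\<pi>. D_H1 \<psi> (xs \<pi>) \<pi>) \<longlongrightarrow> D_H1 \<psi> (xs p) p) (at p within Q)" if "\<psi> \<in> ?\<Psi>" for \<psi>
        using continuous_on_subset[OF D1cont[OF that] Q(3)] p by (simp add: continuous_on_def)
      have conv2: "((\<lambda>\<pi>. D_H2 \<psi> (xs \<pi>) \<pi>) \<longlongrightarrow> D_H2 \<psi> (xs p) p) (at p within Q)" if "\<psi> \<in> ?\<Psi>" for \<psi>
        using continuous_on_subset[OF D2cont[OF that] Q(3)] p by (simp add: continuous_on_def)
      have ev: "\<forall>\<^sub>F \<pi> in at p within Q. ?KKT \<pi> (L \<pi>) (M \<pi>)"
        using LM by (simp add: eventually_at_filter)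
      \<comment> \<open>The selected multipliers are automatically continuous on \<open>Q\<close>:
        stability of independent families controls any selection.\<close>
      note lim = KKT_multipliers_tendsto[OF conv1 indep[OF p] LM[OF p] ev]
      show "(V' \<longlongrightarrow> V' p) (at p within Q)"
        unfolding V'_def by (intro tendsto_intros lim conv2) auto
    qed
    have gat: "has_gateaux_differential ?V \<pi> (V' \<pi>)" if "\<pi> \<in> Q" for \<pi>
      unfolding V'_def using that Q(3) joint xs indep LM by (intro gateaux) blast+
    have "(?V has_derivative blinfun_apply (V' \<pi>)) (at \<pi>)" if "\<pi> \<in> Q" for \<pi>
      using Q(1) that gat V'_cont by (rule has_derivative_of_gateaux_continuous)
    moreover have "unique_KKT_multipliers f k g l h (xs \<pi>) \<pi> (L \<pi>) (M \<pi>)" if "\<pi> \<in> Q" for \<pi>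
      using LM[OF that] indep[OF that] by (rule KKT_multipliers_imp_unique)
    ultimately show ?thesis
      using Q V'_cont V'_def by (intro exI[of _ Q] exI[of _ V']) blast
  qed
  show ?thesis
  proof (intro conjI allI impI)
    fix \<omega> assume "\<exists>d. has_right_dir_deriv xs \<pi>\<^sub>0 \<omega> d"
    from envelope[OF Sol1(2) joint0 Con2 K0 this]
    show "\<exists>lam mu. unique_KKT_multipliers f k g l h (xs \<pi>\<^sub>0) \<pi>\<^sub>0 lam mu \<and>
          has_right_dir_deriv ?V \<pi>\<^sub>0 \<omega>
            (blinfun_apply (D_H2 f (xs \<pi>\<^sub>0) \<pi>\<^sub>0) \<omega>
             + (\<Sum>i=1..k. lam i * blinfun_apply (D_H2 (g i) (xs \<pi>\<^sub>0) \<pi>\<^sub>0) \<omega>)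
             + (\<Sum>j=1..l. mu j * blinfun_apply (D_H2 (h j) (xs \<pi>\<^sub>0) \<pi>\<^sub>0) \<omega>))"
      using unique0 by blast
  next
    assume "\<forall>\<omega>. \<exists>d. has_right_dir_deriv xs \<pi>\<^sub>0 \<omega> d"
    then show "\<exists>lam mu. unique_KKT_multipliers f k g l h (xs \<pi>\<^sub>0) \<pi>\<^sub>0 lam mu \<and>
          has_gateaux_differential ?V \<pi>\<^sub>0
            (D_H2 f (xs \<pi>\<^sub>0) \<pi>\<^sub>0
             + (\<Sum>i=1..k. lam i *\<^sub>R D_H2 (g i) (xs \<pi>\<^sub>0) \<pi>\<^sub>0)
             + (\<Sum>j=1..l. mu j *\<^sub>R D_H2 (h j) (xs \<pi>\<^sub>0) \<pi>\<^sub>0))"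
      using unique0 gateaux[OF Sol1(2) joint0 Con2 K0] by blast
  qed (rule C1; blast)
qed

end
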